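(* Fix an integer $d\ge1$ and $\lambda\in(0,1)$. For each integer $n\ge d$, let $X^n(\cdot)$ be the Markov chain defined in the context, let $\pi^{n,0}(t)$ denote the distribution of the queue length $Q_1^n(t)$ of the first server at time $t\ge 0$ when the system starts empty (i.e. $X^n_i(0)=0$ for all $i\in[m]$), and let $\pi^n$ denote the stationary queue-length distribution of the first server (the law of $\sum_{i\in\partial_1}X_i^n$ under the unique stationary distribution of $X^n(\cdot)$). Then, for each $\epsilon>0$, there exists $\tau=\tau(\epsilon)$, not depending on $n$, such that $$d_{TV}(\pi^{n,0}(t),\pi^n)\le\epsilon\qquad\text{for all }t\ge\tau.$$
   Context: For integers $n\ge d$ let $[n]=\{1,\dots,n\}$ be the set of servers and $m=\binom{n}{d}$. The $m$ subsets of $[n]$ of size $d$ are called classes and are indexed by $i\in[m]$. For a class $i\in[m]$, $\partial_i\subset[n]$ denotes the corresponding set of $d$ servers; for a server $j\in[n]$, $\partial_j\subset[m]$ denotes the set of classes containing $j$. $X^n(\cdot)=(X^n_i(\cdot),i\in[m])$ is the continuous-time Markov chain on $S^n=\mathbb{Z}_+^m$ with transitions, from $x\in S^n$ and for each $i\in[m]$, $$x\to x+e_i\ \text{ at rate } r^{i,n}_+(x)=\frac{n\lambda}{m},\qquad x\to x-e_i\ \text{ at rate } r^{i,n}_-(x)=x_i\sum_{j\in\partial_i}\frac1{q_j},\qquad q_j=\sum_{i'\in\partial_j}x_{i'},$$ where $e_i$ is the $i$-th unit vector and $r^{i,n}_-(x)=0$ when $x_i=0$. For $\lambda<1$ this chain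 is irreducible and positive recurrent, so it has a unique stationary distribution. The queue length at server $j$ is $Q^n_j(t)=\sum_{i\in\partial_j}X^n_i(t)$. $d_{TV}(\mu,\nu)=\sup_A|\mu(A)-\nu(A)|$ is total variation distance between probability measures on $\mathbb{Z}_+$. *)

theory Defs
  imports "HOL-Probability.Probability"
begin

section \<open>Continuous-time Markov chains on a countable state space\<close>

definition transition_function :: "'s set \<Rightarrow> (real \<Rightarrow> 's \<Rightarrow> 's pmf) \<Rightarrow> bool" where
  "transition_function S P \<longleftrightarrow>
     (\<forall>t\<ge>0. \<forall>x\<in>S. set_pmf (P t x) \<subseteq> S) \<and>
     (\<forall>x\<in>S. P 0 x = return_pmf x) \<and>
     (\<forall>s\<ge>0. \<forall>t\<ge>0. \<forall>x\<in>S. P (s + t) x = bind_pmf (P s x) (P t))"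

text \<open>The conservative Q-matrix of the jump rates \<open>r\<close>; the values \<open>r x x\<close> are irrelevant.\<close>

definition generator :: "'s set \<Rightarrow> ('s \<Rightarrow> 's \<Rightarrow> real) \<Rightarrow> 's \<Rightarrow> 's \<Rightarrow> real" where
  "generator S r x y = (if y = x then - (\<Sum>\<^sub>\<infinity>z\<in>S - {x}. r x z) else r x y)"

text \<open>
  Infinitesimal description of a chain with jump rates \<open>r\<close>: for \<open>h\<close> decreasing to 0,
  the probability of moving from \<open>x\<close> to \<open>y\<close> in time \<open>h\<close> is
  \<open>of_bool (y = x) + generator S r x y * h + o(h)\<close>. When the total exit rates are bounded,
  as in the model below (by \<open>n * (lam + 1)\<close>), this determines \<open>P\<close> on \<open>S\<close>.
\<close>

definition has_jump_rates ::
  "'s set \<Rightarrow> ('s \<Rightarrow> 's \<Rightarrow> real) \<Rightarrow> (real \<Rightarrow> 's \<Rightarrow> 's pmf) \<Rightarrow> bool" where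
  "has_jump_rates S r P \<longleftrightarrow>
     (\<forall>x\<in>S. \<forall>y\<in>S.
        ((\<lambda>h. (pmf (P h x) y - of_bool (y = x)) / h) \<longlongrightarrow> generator S r x y) (at_right 0))"

text \<open>
  The Markov property is stated through the finite-dimensional distributions. Regularity of
  the paths is not required, since it does not affect the laws at fixed times.
\<close>

definition markov_process ::
  "'s set \<Rightarrow> (real \<Rightarrow> 's \<Rightarrow> 's pmf) \<Rightarrow> 'w measure \<Rightarrow> (real \<Rightarrow> 'w \<Rightarrow> 's) \<Rightarrow> bool" where
  "markov_process S P M X \<longleftrightarrow>
     prob_space M \<and>
     (\<forall>t\<ge>0. X t \<in> measurable M (count_space S)) \<and>
     (\<forall>N (t :: nat \<Rightarrow> real) x.
        0 \<le> t 0 \<and> (\<forall>k<N. t k < t (Suc k)) \<and> (\<forall>k\<le>N. x k \<in> S) \<longrightarrow>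
        measure M {\<omega> \<in> space M. \<forall>k\<le>N. X (t k) \<omega> = x k} =
          measure M {\<omega> \<in> space M. X (t 0) \<omega> = x 0} *
          (\<Prod>k<N. pmf (P (t (Suc k) - t k) (x k)) (x (Suc k))))"

definition stationary_distribution ::
  "'s set \<Rightarrow> (real \<Rightarrow> 's \<Rightarrow> 's pmf) \<Rightarrow> 's pmf \<Rightarrow> bool" where
  "stationary_distribution S P \<pi> \<longleftrightarrow>
     set_pmf \<pi> \<subseteq> S \<and> (\<forall>t\<ge>0. bind_pmf \<pi> (P t) = \<pi>)"

text \<open>Intended for two probability measures on the same \<open>\<sigma>\<close>-algebra.\<close>

definition tv_dist :: "'a measure \<Rightarrow> 'a measure \<Rightarrow> real" where
  "tv_dist \<mu> \<nu> = (SUP A\<in>sets \<mu>. \<bar>measure \<mu> A - measure \<nu> A\<bar>)"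

section \<open>The parallel server system\<close>

text \<open>
  A class is represented by its set of \<open>d\<close> servers rather than by an index in
  \<open>{1..n choose d}\<close>, and a state is a function on classes, extended by 0.
\<close>

type_synonym state = "nat set \<Rightarrow> nat"

definition classes :: "nat \<Rightarrow> nat \<Rightarrow> nat set set" where
  "classes n d = {c. c \<subseteq> {1..n} \<and> card c = d}"

definition states :: "nat \<Rightarrow> nat \<Rightarrow> state set" where
  "states n d = {x. \<forall>c. c \<notin> classes n d \<longrightarrow> x c = 0}"

definition queue :: "nat \<Rightarrow> nat \<Rightarrow> state \<Rightarrow> nat \<Rightarrow> nat" where
  "queue n d x j = (\<Sum>c\<in>{c \<in> classes n d. j \<in> c}. x c)"

definition arrival_rate :: "nat \<Rightarrow> nat \<Rightarrow> real \<Rightarrow> real" where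
  "arrival_rate n d lam = real n * lam / real (n choose d)"

definition departure_rate :: "nat \<Rightarrow> nat \<Rightarrow> state \<Rightarrow> nat set \<Rightarrow> real" where
  "departure_rate n d x c = real (x c) * (\<Sum>j\<in>c. 1 / real (queue n d x j))"

definition jump_rate :: "nat \<Rightarrow> nat \<Rightarrow> real \<Rightarrow> state \<Rightarrow> state \<Rightarrow> real" where
  "jump_rate n d lam x y =
     (\<Sum>c\<in>classes n d.
        (if y = x(c := x c + 1) then arrival_rate n d lam else 0) +
        (if 0 < x c \<and> y = x(c := x c - 1) then departure_rate n d x c else 0))"

end

theory Submission
  imports Defs
begin

text \<open>
  The generator steps \<open>1 + h * G\<close> preserve functions that are increasing in the coordinatewise
  order, and they approximate the transition semigroup (Euler scheme). So the chain is
  stochastically monotone, and the tail gaps \<open>a k = \<pi>(Q > k) - P(Q t > k)\<close> of the chain started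
  empty are nonnegative and nonincreasing in \<open>t\<close>.

  The total number of jobs has drift \<open>n * lam\<close> minus the number of busy servers. Integrating this up
  to time \<open>t\<close> bounds the busy-server deficit, that is \<open>n * a 0\<close>, by the stationary mean number of
  jobs divided by \<open>t\<close>. The drift of the sum of the squared queues shows that this mean is at most
  a constant times \<open>n\<close>.

  Higher tails are controlled by the first one, at a fixed time. If \<open>R\<close> is the departure rate at
  the server, then \<open>1 \<le> R \<le> d * Q\<close> when \<open>Q > 0\<close>, and \<open>R\<close> decreases in the state when \<open>Q\<close> is
  fixed. Hence \<open>d * (k + 1) * 1{Q > k} - R * 1{Q = k + 1} - 1{Q > k + 1}\<close> is increasing, and
  comparing its two expectations gives \<open>a (k + 1) \<le> d * (k + 1 + lam) * a k\<close>.
\<close>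

section \<open>Expectations under a pmf\<close>

text \<open>Only the derivatives at time 0 of the transition probabilities are given, so the forward
  equation has to be derived, and it is obtained for bounded functions. Every drift argument with an
  unbounded function is therefore run on a truncation, whose error vanishes as the level grows; no
  moment of the stationary law is assumed finite. The service rate at a server depends on the queues
  of other servers, so the balance equation for one tail does not close. Monotonicity supplies the
  missing control over the part of the rate that the queue length alone does not determine.
  Uniformity in \<open>n\<close> comes from matching orders: the mean number of jobs and the summed
  deficit are both of order \<open>n\<close>, and exchangeability divides by \<open>n\<close>
  exactly. Tail gaps measure upper sets only. For an arbitrary set their sum up to a level
  \<open>K\<close> enters, together with the mass beyond \<open>K\<close>, which Markov's inequality
  makes small uniformly in \<open>n\<close>.\<close>

abbreviation expect :: "'s pmf \<Rightarrow> ('s \<Rightarrow> real) \<Rightarrow> real" where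
  "expect p f \<equiv> measure_pmf.expectation p f"

lemma integrable_pmf_bounded:
  fixes f :: "'s \<Rightarrow> real"
  assumes "\<And>y. y \<in> set_pmf p \<Longrightarrow> \<bar>f y\<bar> \<le> B"
  shows "integrable (measure_pmf p) f"
  by (rule measure_pmf.integrable_const_bound[where B=B]) (auto simp: AE_measure_pmf_iff assms)

lemma expect_mono:
  assumes "\<And>y. y \<in> set_pmf p \<Longrightarrow> f y \<le> g y"
    and "\<And>y. y \<in> set_pmf p \<Longrightarrow> \<bar>f y\<bar> \<le> B" and "\<And>y. y \<in> set_pmf p \<Longrightarrow> \<bar>g y\<bar> \<le> C"
  shows "expect p f \<le> expect p g"
  by (intro integral_mono_AE integrable_pmf_bounded[of p f B] integrable_pmf_bounded[of p g C])
     (auto simp: AE_measure_pmf_iff assms)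

lemma expect_abs_le:
  assumes "\<And>y. y \<in> set_pmf p \<Longrightarrow> \<bar>f y\<bar> \<le> B"
  shows "\<bar>expect p f\<bar> \<le> B"
proof -
  have "\<bar>expect p f\<bar> \<le> expect p (\<lambda>y. \<bar>f y\<bar>)"
    by (rule integral_abs_bound)
  also have "\<dots> \<le> expect p (\<lambda>_. B)"
    by (rule expect_mono[where B=B and C=B]) (use assms in fastforce)+
  finally show ?thesis by simp
qed

lemma expect_bind:
  fixes f :: "'t \<Rightarrow> real"
  assumes "\<And>y. \<bar>f y\<bar> \<le> B"
  shows "expect (bind_pmf p q) f = expect p (\<lambda>y. expect (q y) f)"
  unfolding measure_pmf_bind
  by (rule integral_bind[where K="count_space UNIV" and B=B and B'=1])
     (use assms measurable_measure_pmf[of q] in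
       \<open>auto simp: measure_pmf.finite_measure_axioms measure_pmf.emeasure_space_1 simp del: space_measure_pmf\<close>)

lemma expect_of_bool: "expect p (\<lambda>y. of_bool (y \<in> A)) = measure_pmf.prob p A"
proof -
  have "(\<lambda>y. of_bool (y \<in> A)) = (indicator A :: _ \<Rightarrow> real)"
    by (auto simp: indicator_def)
  then show ?thesis by simp
qed

lemma expect_dominated_at_right:
  assumes "\<And>y. y \<in> set_pmf p \<Longrightarrow> ((\<lambda>h. g h y) \<longlongrightarrow> f y) (at_right (0::real))"
    and "\<And>h y. h > 0 \<Longrightarrow> y \<in> set_pmf p \<Longrightarrow> \<bar>g h y\<bar> \<le> B"
  shows "((\<lambda>h. expect p (g h)) \<longlongrightarrow> expect p f) (at_right 0)"
  unfolding filterlim_at_right_to_top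
proof (rule integral_dominated_convergence_at_top[where w="\<lambda>_. B"])
  show "AE x in measure_pmf p. ((\<lambda>i. g (inverse i) x) \<longlongrightarrow> f x) at_top"
    using assms(1) by (auto simp: AE_measure_pmf_iff filterlim_at_right_to_top)
  show "\<forall>\<^sub>F i in at_top. AE x in measure_pmf p. norm (g (inverse i) x) \<le> B"
    using eventually_gt_at_top[of 0] by eventually_elim (auto simp: AE_measure_pmf_iff assms(2))
qed auto

lemma expect_diff_const:
  assumes "\<And>y. y \<in> set_pmf p \<Longrightarrow> \<bar>f y\<bar> \<le> B"
  shows "expect p (\<lambda>y. f y - c) = expect p f - c"
  using integrable_pmf_bounded[of p f B] assms by simp

text \<open>The error terms of the truncation arguments are multiples of such probabilities; this
  removes the level \<open>N\<close> in the limit.\<close>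

lemma prob_tail_tendsto_0:
  fixes g :: "'s \<Rightarrow> real"
  shows "(\<lambda>N. expect p (\<lambda>x. of_bool (real N < g x))) \<longlonglongrightarrow> 0"
proof -
  have "(\<lambda>N. expect p (\<lambda>x. of_bool (real N < g x))) \<longlonglongrightarrow> expect p (\<lambda>x. 0)"
  proof (rule integral_dominated_convergence[where w="\<lambda>_. 1"])
    have "(\<lambda>i. of_bool (real i < g x) :: real) \<longlonglongrightarrow> 0" for x
    proof (rule tendsto_eventually)
      obtain M :: nat where "g x \<le> real M" using real_arch_simple by blast
      then show "\<forall>\<^sub>F i in sequentially. of_bool (real i < g x) = (0::real)"
        by (intro eventually_sequentiallyI[of M]) auto
    qed
    then show "AE x in measure_pmf p. (\<lambda>i. of_bool (real i < g x) :: real) \<longlonglongrightarrow> 0"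
      by simp
  qed auto
  then show ?thesis by simp
qed

section \<open>Semigroups with bounded jump rates\<close>

text \<open>The rates enter through derivatives at time 0, separately for each pair of states. The
  common bound \<open>L\<close> on the exit rates makes the short-time estimates uniform in the
  starting state; finite neighbour sets turn the generator into a finite sum.\<close>

locale bounded_jump_semigroup =
  fixes S :: "'s set" and r :: "'s \<Rightarrow> 's \<Rightarrow> real" and P :: "real \<Rightarrow> 's \<Rightarrow> 's pmf" and L :: real
  assumes transition: "transition_function S P"
    and rates: "has_jump_rates S r P"
    and rate_nonneg: "x \<in> S \<Longrightarrow> y \<in> S \<Longrightarrow> 0 \<le> r x y"
    and finite_nbs: "x \<in> S \<Longrightarrow> finite {y \<in> S - {x}. r x y \<noteq> 0}"
    and exit_rate: "x \<in> S \<Longrightarrow> (\<Sum>y\<in>{y \<in> S - {x}. r x y \<noteq> 0}. r x y) \<le> L"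
    and L_pos: "0 < L"
begin

abbreviation nbs :: "'s \<Rightarrow> 's set" where
  "nbs x \<equiv> {y \<in> S - {x}. r x y \<noteq> 0}"

text \<open>Set to 0 outside \<open>S\<close>, so that bounds on \<open>gen f\<close> hold at every
  state without a side condition.\<close>

definition gen :: "('s \<Rightarrow> real) \<Rightarrow> 's \<Rightarrow> real" where
  "gen f x = (if x \<in> S then \<Sum>y\<in>nbs x. r x y * (f y - f x) else 0)"

definition step :: "real \<Rightarrow> ('s \<Rightarrow> real) \<Rightarrow> 's \<Rightarrow> real" where
  "step h f = (\<lambda>x. f x + h * gen f x)"

lemma set_P: "t \<ge> 0 \<Longrightarrow> x \<in> S \<Longrightarrow> set_pmf (P t x) \<subseteq> S"
  using transition by (auto simp: transition_function_def)

lemma P_0: "x \<in> S \<Longrightarrow> P 0 x = return_pmf x"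
  using transition by (auto simp: transition_function_def)

lemma P_add: "s \<ge> 0 \<Longrightarrow> t \<ge> 0 \<Longrightarrow> x \<in> S \<Longrightarrow> P (s + t) x = bind_pmf (P s x) (P t)"
  using transition by (auto simp: transition_function_def)

lemma generator_diag:
  assumes "x \<in> S" shows "generator S r x x = - (\<Sum>y\<in>nbs x. r x y)"
proof -
  have "(\<Sum>\<^sub>\<infinity>z\<in>S - {x}. r x z) = (\<Sum>\<^sub>\<infinity>z\<in>nbs x. r x z)"
    by (rule infsum_cong_neutral) auto
  then show ?thesis
    using finite_nbs[OF assms] by (simp add: generator_def)
qed

lemma sum_generator:
  assumes "x \<in> S"
  shows "(\<Sum>y\<in>insert x (nbs x). generator S r x y * f y) = gen f x"
proof -
  have "(\<Sum>y\<in>nbs x. generator S r x y * f y) = (\<Sum>y\<in>nbs x. r x y * f y)"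
    by (rule sum.cong) (auto simp: generator_def)
  then show ?thesis
    using assms finite_nbs[OF assms]
    by (simp add: generator_diag gen_def right_diff_distrib sum_subtractf sum_distrib_right)
qed

lemma gen_bounded:
  assumes "\<And>y. \<bar>f y\<bar> \<le> B" shows "\<bar>gen f x\<bar> \<le> 2 * B * L"
proof (cases "x \<in> S")
  case True
  have B: "0 \<le> B" using assms[of x] by linarith
  have "\<bar>gen f x\<bar> \<le> (\<Sum>y\<in>nbs x. \<bar>r x y * (f y - f x)\<bar>)"
    using True by (simp add: gen_def)
  also have "\<dots> \<le> (\<Sum>y\<in>nbs x. r x y * (2 * B))"
  proof (rule sum_mono)
    fix y assume y: "y \<in> nbs x"
    have "\<bar>f y - f x\<bar> \<le> 2 * B" using assms[of x] assms[of y] by linarith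
    then show "\<bar>r x y * (f y - f x)\<bar> \<le> r x y * (2 * B)"
      using rate_nonneg[OF True, of y] y by (simp add: abs_mult mult_left_mono)
  qed
  also have "\<dots> = (\<Sum>y\<in>nbs x. r x y) * (2 * B)"
    by (simp add: sum_distrib_right)
  also have "\<dots> \<le> L * (2 * B)"
    using exit_rate[OF True] B by (intro mult_right_mono) auto
  finally show ?thesis by (simp add: mult.commute)
next
  case False
  then show ?thesis using L_pos assms[of x] by (simp add: gen_def)
qed

text \<open>The rates prescribe limits only pointwise in the target state. For a bounded
  \<open>f\<close> it remains to see that the mass outside \<open>x\<close> and its neighbours is
  \<open>o(h)\<close>, and this follows because the generator row sums to 0 over that finite
  set.\<close>

lemma expect_P_deriv_0:
  assumes x: "x \<in> S" and f: "\<And>y. \<bar>f y\<bar> \<le> B"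
  shows "((\<lambda>h. (expect (P h x) f - f x) / h) \<longlongrightarrow> gen f x) (at_right 0)"
proof -
  define N where "N = insert x (nbs x)"
  have N: "finite N" "x \<in> N" "N \<subseteq> S"
    using x finite_nbs[OF x] by (auto simp: N_def)
  define q where "q h y = (pmf (P h x) y - of_bool (y = x)) / h" for h y
  have q: "((\<lambda>h. \<Sum>y\<in>N. q h y * g y) \<longlongrightarrow> gen g x) (at_right 0)" for g
    unfolding sum_generator[OF x, symmetric] N_def[symmetric]
  proof (intro tendsto_intros)
    fix y assume "y \<in> N"
    then show "((\<lambda>h. q h y) \<longlongrightarrow> generator S r x y) (at_right 0)"
      using rates N x unfolding has_jump_rates_def q_def by blast
  qed
  have f2: "\<bar>f y * indicator (- N) y\<bar> \<le> B" for y
    using f[of y] by (auto simp: indicator_def)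
  have decomp: "expect (P h x) f = (\<Sum>y\<in>N. pmf (P h x) y * f y) + expect (P h x) (\<lambda>y. f y * indicator (- N) y)" for h
  proof -
    have "expect (P h x) f = expect (P h x) (\<lambda>y. f y * indicator N y + f y * indicator (- N) y)"
      by (rule Bochner_Integration.integral_cong) (auto simp: indicator_def)
    also have "\<dots> = expect (P h x) (\<lambda>y. f y * indicator N y) + expect (P h x) (\<lambda>y. f y * indicator (- N) y)"
      by (rule Bochner_Integration.integral_add)
         (rule integrable_pmf_bounded[where B=B], use f in \<open>auto simp: indicator_def intro: order_trans[OF abs_ge_zero]\<close>)+
    also have "expect (P h x) (\<lambda>y. f y * indicator N y) = (\<Sum>y\<in>N. f y * indicator N y * pmf (P h x) y)"
      using N by (intro integral_measure_pmf_real) (auto simp: indicator_def)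
    also have "\<dots> = (\<Sum>y\<in>N. pmf (P h x) y * f y)"
      by (rule sum.cong) auto
    finally show ?thesis .
  qed
  have tail: "\<bar>expect (P h x) (\<lambda>y. f y * indicator (- N) y)\<bar> \<le> B * (1 - (\<Sum>y\<in>N. pmf (P h x) y))" for h
  proof -
    have "\<bar>expect (P h x) (\<lambda>y. f y * indicator (- N) y)\<bar> \<le> expect (P h x) (\<lambda>y. \<bar>f y * indicator (- N) y\<bar>)"
      by (rule integral_abs_bound)
    also have "\<dots> \<le> expect (P h x) (\<lambda>y. B * indicator (- N) y)"
      by (rule expect_mono[where B=B and C=B])
         (use f in \<open>auto simp: indicator_def intro: order_trans[OF abs_ge_zero]\<close>)
    also have "\<dots> = B * measure_pmf.prob (P h x) (- N)" by simp
    also have "measure_pmf.prob (P h x) (- N) = 1 - (\<Sum>y\<in>N. pmf (P h x) y)"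
      using measure_pmf.prob_compl[of N "P h x"] N
      by (simp add: measure_measure_pmf_finite Compl_eq_Diff_UNIV)
    finally show ?thesis .
  qed
  have sum_bool: "(\<Sum>y\<in>N. of_bool (y = x) * g y) = g x" for g :: "'s \<Rightarrow> real"
    using N by (subst sum.remove[of _ x]) (auto intro!: sum.neutral)
  have qs: "(\<Sum>y\<in>N. q h y * g y) = ((\<Sum>y\<in>N. pmf (P h x) y * g y) - g x) / h" for h g
    by (simp add: q_def diff_divide_distrib left_diff_distrib sum_subtractf sum_divide_distrib[symmetric]
        sum_bool flip: times_divide_eq_left)
       (simp add: sum_divide_distrib[symmetric] times_divide_eq_left sum_bool)
  have eq: "(expect (P h x) f - f x) / h
     = (\<Sum>y\<in>N. q h y * f y) + expect (P h x) (\<lambda>y. f y * indicator (- N) y) / h" for h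
    by (simp add: qs decomp[of h] add_divide_distrib diff_divide_distrib)
  have lim0: "((\<lambda>h. expect (P h x) (\<lambda>y. f y * indicator (- N) y) / h) \<longlongrightarrow> 0) (at_right 0)"
  proof (rule tendsto_rabs_zero_cancel, rule tendsto_sandwich[OF _ _ tendsto_const])
    have "((\<lambda>h. - B * (\<Sum>y\<in>N. q h y * 1)) \<longlongrightarrow> - B * gen (\<lambda>_. 1) x) (at_right 0)"
      by (intro tendsto_intros q)
    moreover have "gen (\<lambda>_. 1) x = 0"
      by (simp add: gen_def)
    ultimately show "((\<lambda>h. - B * (\<Sum>y\<in>N. q h y * 1)) \<longlongrightarrow> 0) (at_right 0)"
      by simp
    show "\<forall>\<^sub>F h in at_right 0. \<bar>expect (P h x) (\<lambda>y. f y * indicator (- N) y) / h\<bar> \<le> - B * (\<Sum>y\<in>N. q h y * 1)"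
      using eventually_at_right_less[of 0]
    proof eventually_elim
      case (elim h)
      have "- B * (\<Sum>y\<in>N. q h y * 1) = B * (1 - (\<Sum>y\<in>N. pmf (P h x) y)) / h"
        unfolding qs by (simp add: field_simps)
      then show ?case
        using elim tail[of h] by (simp add: abs_divide divide_right_mono)
    qed
  qed auto
  show ?thesis
    unfolding eq using tendsto_add[OF q[of f] lim0] by simp
qed

text \<open>Being at \<open>x\<close> after each of \<open>k\<close> short steps is one way to be
  there at the end, so the return probability dominates a \<open>k\<close>-th power. The derivative
  at 0 bounds one short step, Bernoulli's inequality the power. A limit whose speed may depend on
  \<open>x\<close> thus becomes a bound uniform in \<open>x\<close> and valid for all
  \<open>h\<close>.\<close>

lemma pmf_P_self:
  assumes x: "x \<in> S" and h: "h \<ge> 0"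
  shows "1 - L * h \<le> pmf (P h x) x"
proof (cases "h = 0")
  case True
  then show ?thesis using P_0[OF x] by simp
next
  case False
  then have hp: "h > 0" using h by simp
  have pow: "pmf (P s x) x ^ k \<le> pmf (P (real k * s) x) x" if "s \<ge> 0" for s k
  proof (induction k)
    case 0
    then show ?case using P_0[OF x] by simp
  next
    case (Suc k)
    have "pmf (P s x) x ^ Suc k \<le> pmf (P s x) x * pmf (P (real k * s) x) x"
      using Suc by (simp add: mult_left_mono)
    also have "\<dots> = expect (P s x) (\<lambda>y. pmf (P (real k * s) x) x * indicator {x} y)"
      by (simp add: measure_pmf_single)
    also have "\<dots> \<le> expect (P s x) (\<lambda>y. pmf (P (real k * s) y) x)"
      by (rule expect_mono[where B=1 and C=1]) (auto simp: indicator_def pmf_le_1)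
    also have "\<dots> = pmf (P (s + real k * s) x) x"
      using that x by (subst P_add) (auto simp: pmf_bind)
    also have "s + real k * s = real (Suc k) * s" by (simp add: algebra_simps)
    finally show ?case .
  qed
  have L0: "((\<lambda>s. (pmf (P s x) x - 1) / s) \<longlongrightarrow> generator S r x x) (at_right 0)"
    using rates x by (force simp: has_jump_rates_def)
  have gx: "generator S r x x \<ge> - L"
    using generator_diag[OF x] exit_rate[OF x] by simp
  have "1 - (L + e) * h \<le> pmf (P h x) x" if e: "e > 0" for e
  proof -
    have "\<forall>\<^sub>F s in at_right 0. (pmf (P s x) x - 1) / s > - (L + e)"
      by (rule order_tendstoD(1)[OF L0]) (use gx e in simp)
    then obtain b where b: "b > 0" "\<And>s. 0 < s \<Longrightarrow> s < b \<Longrightarrow> (pmf (P s x) x - 1) / s > - (L + e)"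
      by (auto simp: eventually_at_right_field)
    \<comment> \<open>The first summand forces the step length \<open>h / k\<close> below
      \<open>b\<close>; the second makes the base in Bernoulli's inequality nonnegative.\<close>
    obtain k :: nat where k: "real k > h / b + (L + e) * h" using reals_Archimedean2 by blast
    have posL: "(L + e) * h > 0" using L_pos e hp by simp
    have kp: "real k > 0" using k posL b hp by (smt (verit) divide_pos_pos)
    define s where "s = h / real k"
    have s: "s > 0" "real k * s = h" using kp hp by (auto simp: s_def)
    have "h / b < real k" using k posL by linarith
    then have "s < b" using kp b by (simp add: s_def field_simps)
    then have "pmf (P s x) x - 1 \<ge> - (L + e) * s"
      using b(2)[OF s(1)] s(1) by (simp add: field_simps)
    then have p1: "1 - (L + e) * s \<le> pmf (P s x) x" by (simp add: algebra_simps)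
    have "(L + e) * h < real k" using k b hp by (smt (verit) divide_pos_pos)
    then have le1: "(L + e) * s \<le> 1" using kp by (simp add: s_def field_simps)
    have "1 - (L + e) * h = 1 + real k * (- ((L + e) * s))"
      using s(2) by (simp add: algebra_simps)
    also have "\<dots> \<le> (1 + (- ((L + e) * s))) ^ k"
      by (rule Bernoulli_inequality) (use le1 in simp)
    also have "\<dots> \<le> pmf (P s x) x ^ k"
      using p1 le1 by (intro power_mono) auto
    also have "\<dots> \<le> pmf (P h x) x" using pow[of s k] s by simp
    finally show ?thesis .
  qed
  then have "1 - L * h - pmf (P h x) x \<le> e" if "e > 0" for e
  proof -
    have "1 - (L + e / h) * h \<le> pmf (P h x) x"
      using \<open>\<And>e. 0 < e \<Longrightarrow> 1 - (L + e) * h \<le> pmf (P h x) x\<close>[of "e / h"] that hp by simp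
    then show ?thesis using hp by (simp add: algebra_simps)
  qed
  then have "1 - L * h - pmf (P h x) x \<le> 0" by (rule field_le_epsilon[where y=0, simplified])
  then show ?thesis by simp
qed

text \<open>The value differs from \<open>f x\<close> only if the chain sits elsewhere at time
  \<open>h\<close>, which has probability at most \<open>L * h\<close>, and then by at most
  \<open>2 * B\<close>.\<close>

lemma expect_P_close:
  assumes x: "x \<in> S" and h: "h \<ge> 0" and f: "\<And>y. \<bar>f y\<bar> \<le> B"
  shows "\<bar>expect (P h x) f - f x\<bar> \<le> 2 * B * L * h"
proof -
  have "expect (P h x) f - f x = expect (P h x) (\<lambda>y. f y - f x)"
    by (rule expect_diff_const[symmetric, OF f])
  also have "\<bar>\<dots>\<bar> \<le> expect (P h x) (\<lambda>y. \<bar>f y - f x\<bar>)"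
    by (rule integral_abs_bound)
  also have "\<dots> \<le> expect (P h x) (\<lambda>y. 2 * B * indicator (- {x}) y)"
  proof (rule expect_mono[where B="2*B" and C="2*B"])
    fix y
    have "\<bar>f y - f x\<bar> \<le> 2 * B" using f[of x] f[of y] by linarith
    then show "\<bar>f y - f x\<bar> \<le> 2 * B * indicator (- {x}) y" "\<bar>\<bar>f y - f x\<bar>\<bar> \<le> 2 * B"
       "\<bar>2 * B * indicator (- {x}) y\<bar> \<le> 2 * B"
      by (auto simp: indicator_def)
  qed
  also have "\<dots> = 2 * B * (1 - pmf (P h x) x)"
    using measure_pmf.prob_compl[of "{x}" "P h x"]
    by (simp add: measure_pmf_single Compl_eq_Diff_UNIV)
  also have "\<dots> \<le> 2 * B * (L * h)"
    using pmf_P_self[OF x h] f[of x] by (intro mult_left_mono) auto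
  finally show ?thesis by (simp add: mult.assoc)
qed

lemma expect_P_add:
  assumes "s \<ge> 0" "t \<ge> 0" "x \<in> S" "\<And>y. \<bar>f y\<bar> \<le> B"
  shows "expect (P (s + t) x) f = expect (P s x) (\<lambda>y. expect (P t y) f)"
  using assms by (simp add: P_add expect_bind[where B=B])

lemma expect_P_lipschitz:
  assumes s: "s \<ge> 0" and h: "h \<ge> 0" and x: "x \<in> S" and f: "\<And>y. \<bar>f y\<bar> \<le> B"
  shows "\<bar>expect (P (s + h) x) f - expect (P s x) f\<bar> \<le> 2 * B * L * h"
proof -
  have f': "\<bar>expect (P h y) f\<bar> \<le> B" for y by (rule expect_abs_le[OF f])
  have "expect (P (s + h) x) f - expect (P s x) f = expect (P s x) (\<lambda>y. expect (P h y) f - f y)"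
    unfolding expect_P_add[OF s h x f]
    by (rule Bochner_Integration.integral_diff[symmetric]) (rule integrable_pmf_bounded[where B=B], use f f' in auto)+
  also have "\<bar>\<dots>\<bar> \<le> 2 * B * L * h"
    by (rule expect_abs_le, rule expect_P_close) (use set_P[OF s x] h f in auto)
  finally show ?thesis .
qed

section \<open>The forward equation\<close>

definition quot :: "real \<Rightarrow> ('s \<Rightarrow> real) \<Rightarrow> 's \<Rightarrow> real" where
  "quot h f = (\<lambda>y. (expect (P h y) f - f y) / h)"

lemma quot_bounded:
  assumes "y \<in> S" "h > 0" "\<And>y. \<bar>f y\<bar> \<le> B"
  shows "\<bar>quot h f y\<bar> \<le> 2 * B * L"
  using expect_P_close[of y h f B] assms by (simp add: quot_def field_simps)

lemma expect_quot:
  assumes s: "s \<ge> 0" and h: "h > 0" and x: "x \<in> S" and f: "\<And>y. \<bar>f y\<bar> \<le> B"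
  shows "expect (P s x) (quot h f) = (expect (P (s + h) x) f - expect (P s x) f) / h"
proof -
  have f': "\<bar>expect (P h y) f\<bar> \<le> B" for y by (rule expect_abs_le[OF f])
  have "expect (P (s + h) x) f - expect (P s x) f = expect (P s x) (\<lambda>y. expect (P h y) f - f y)"
    unfolding expect_P_add[OF s less_imp_le[OF h] x f]
    by (rule Bochner_Integration.integral_diff[symmetric]) (rule integrable_pmf_bounded[where B=B], use f f' in auto)+
  then show ?thesis by (simp add: quot_def)
qed

lemma quot_tendsto:
  assumes "set_pmf p \<subseteq> S" and f: "\<And>y. \<bar>f y\<bar> \<le> B"
  shows "((\<lambda>h. expect p (quot h f)) \<longlongrightarrow> expect p (gen f)) (at_right 0)"
proof (rule expect_dominated_at_right[where B="2*B*L"])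
  fix y assume y: "y \<in> set_pmf p"
  then show "((\<lambda>h. quot h f y) \<longlongrightarrow> gen f y) (at_right 0)"
    using expect_P_deriv_0[of y f B] assms by (auto simp: quot_def)
  show "\<bar>quot h f y\<bar> \<le> 2 * B * L" if "h > 0" for h
    using quot_bounded[of y h f B] assms that y by auto
qed

text \<open>For the right derivative the semigroup property moves the increment inside
  \<open>P t x\<close>. For the left derivative the outer time is \<open>t - h\<close>; as the
  quotients are bounded by \<open>2 * B * L\<close> uniformly in \<open>h\<close>, the Lipschitz
  estimate in time allows replacing it by \<open>t\<close>.\<close>

lemma expect_P_deriv:
  assumes t: "t > 0" and x: "x \<in> S" and f: "\<And>y. \<bar>f y\<bar> \<le> B"
  shows "((\<lambda>s. expect (P s x) f) has_real_derivative expect (P t x) (gen f)) (at t)"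
proof -
  have Lq: "((\<lambda>h. expect (P t x) (quot h f)) \<longlongrightarrow> expect (P t x) (gen f)) (at_right 0)"
    by (rule quot_tendsto[OF _ f]) (use set_P t x in auto)
  have R: "((\<lambda>y. (expect (P y x) f - expect (P t x) f) / (y - t)) \<longlongrightarrow> expect (P t x) (gen f)) (at_right t)"
    unfolding filterlim_at_right_to_0[of _ _ t]
  proof (rule Lim_transform_eventually[OF Lq])
    show "\<forall>\<^sub>F h in at_right 0. expect (P t x) (quot h f)
        = (expect (P (h + t) x) f - expect (P t x) f) / (h + t - t)"
      using eventually_at_right_less[of 0] by eventually_elim (use expect_quot[of t _ x f B] t x f in \<open>simp add: add.commute\<close>)
  qed
  have "((\<lambda>y. (expect (P y x) f - expect (P t x) f) / (y - t)) \<longlongrightarrow> expect (P t x) (gen f)) (at_left t)"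
    unfolding filterlim_at_left_to_right[of _ _ t] filterlim_at_right_to_0[of _ _ "- t"]
  proof (rule Lim_transform_eventually)
    have "((\<lambda>h. expect (P (t - h) x) (quot h f) - expect (P t x) (quot h f)) \<longlongrightarrow> 0) (at_right 0)"
    proof (rule tendsto_rabs_zero_cancel, rule tendsto_sandwich[OF _ _ tendsto_const])
      show "((\<lambda>h. 2 * (2 * B * L) * L * h) \<longlongrightarrow> 0) (at_right 0)"
        by (auto intro!: tendsto_eq_intros)
      show "\<forall>\<^sub>F h in at_right 0. \<bar>expect (P (t - h) x) (quot h f) - expect (P t x) (quot h f)\<bar> \<le> 2 * (2 * B * L) * L * h"
        using eventually_at_right_less[of 0] eventually_at_right_real[OF t]
      proof eventually_elim
        case (elim h)
        \<comment> \<open>The quotients are controlled on \<open>S\<close>; the cut-off version is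
          bounded everywhere and has the same expectations, since the chain stays in
          \<open>S\<close>.\<close>
        define g where "g y = (if y \<in> S then quot h f y else 0)" for y
        have B: "B \<ge> 0" using f[of x] by linarith
        have g: "\<bar>g y\<bar> \<le> 2 * B * L" for y
          using quot_bounded[OF _ elim(1) f, of y] B L_pos by (simp add: g_def)
        have eq: "expect (P s x) (quot h f) = expect (P s x) g" if "s \<ge> 0" for s
          by (rule integral_cong_AE) (use set_P[OF that x] in \<open>auto simp: AE_measure_pmf_iff g_def\<close>)
        show ?case
          using expect_P_lipschitz[of "t - h" h x g "2*B*L"] g x elim
          by (auto simp: eq abs_minus_commute)
      qed
    qed auto
    from tendsto_add[OF this Lq]
    show "((\<lambda>h. expect (P (t - h) x) (quot h f)) \<longlongrightarrow> expect (P t x) (gen f)) (at_right 0)"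
      by simp
    show "\<forall>\<^sub>F h in at_right 0. expect (P (t - h) x) (quot h f)
        = (expect (P (- (h + - t)) x) f - expect (P t x) f) / (- (h + - t) - t)"
      using eventually_at_right_less[of 0] eventually_at_right_real[OF t]
    proof eventually_elim
      case (elim h)
      then show ?case using expect_quot[of "t - h" h x f B] x f
        by (simp add: minus_divide_left)
    qed
  qed
  with R show ?thesis
    unfolding has_field_derivative_iff by (subst filterlim_at_split) blast
qed

section \<open>Mean value formula and Euler scheme\<close>

lemma expect_P_continuous:
  assumes x: "x \<in> S" and f: "\<And>y. \<bar>f y\<bar> \<le> B"
  shows "continuous_on {0..T} (\<lambda>s. expect (P s x) f)"
proof (rule lipschitz_on_continuous_on, rule lipschitz_onI)
  have "B \<ge> 0" using f[of x] by linarith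
  then show "0 \<le> 2 * B * L" using L_pos by simp
next
  fix s t assume st: "s \<in> {0..T}" "t \<in> {0..T}"
  show "dist (expect (P s x) f) (expect (P t x) f) \<le> 2 * B * L * dist s t"
    using expect_P_lipschitz[of s "t - s" x f B] expect_P_lipschitz[of t "s - t" x f B] st x f
    by (cases "s \<le> t") (auto simp: dist_real_def abs_minus_commute)
qed

text \<open>Dynkin's formula in mean-value form, which avoids integration over time. The
  intermediate time \<open>z\<close> is unknown, so its uses rest on estimates that are uniform or
  monotone in time.\<close>

lemma expect_P_mvt:
  assumes h: "h > 0" and x: "x \<in> S" and f: "\<And>y. \<bar>f y\<bar> \<le> B"
  obtains z where "0 < z" "z < h" "expect (P h x) f - f x = h * expect (P z x) (gen f)"
proof -
  have "\<exists>l z. 0 < z \<and> z < h \<and> DERIV (\<lambda>s. expect (P s x) f) z :> l \<and>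
      expect (P h x) f - expect (P 0 x) f = (h - 0) * l"
  proof (rule MVT[OF h expect_P_continuous[where f=f and B=B, OF x f]])
    show "(\<lambda>s. expect (P s x) f) differentiable at z" if "0 < z" "z < h" for z
      using expect_P_deriv[of z x f B] x f that by (auto simp: real_differentiable_def)
  qed
  then obtain l z where z: "0 < z" "z < h" "DERIV (\<lambda>s. expect (P s x) f) z :> l"
      "expect (P h x) f - f x = h * l"
    using P_0[OF x] by auto
  have "l = expect (P z x) (gen f)"
    by (rule DERIV_unique[OF z(3) expect_P_deriv[OF z(1) x f]])
  then show ?thesis using z that by blast
qed

text \<open>The error is uniform in \<open>x\<close>, so the errors of the \<open>k\<close> Euler steps of size \<open>t / k\<close> add up to \<open>O(1 / k)\<close>.\<close>

lemma expect_P_second_order: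
  assumes h: "h \<ge> 0" and x: "x \<in> S" and f: "\<And>y. \<bar>f y\<bar> \<le> B"
  shows "\<bar>expect (P h x) f - step h f x\<bar> \<le> 4 * B * L\<^sup>2 * h\<^sup>2"
proof (cases "h = 0")
  case True
  then show ?thesis using P_0[OF x] by (simp add: step_def)
next
  case False
  then have hp: "h > 0" using h by simp
  have B: "B \<ge> 0" using f[of x] by linarith
  obtain z where z: "0 < z" "z < h" "expect (P h x) f - f x = h * expect (P z x) (gen f)"
    by (rule expect_P_mvt[OF hp x f])
  have "\<bar>expect (P z x) (gen f) - gen f x\<bar> \<le> 2 * (2 * B * L) * L * z"
    using z by (intro expect_P_close[OF x] gen_bounded f) auto
  also have "\<dots> \<le> 2 * (2 * B * L) * L * h"
    using z B L_pos by (intro mult_left_mono) auto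
  finally have *: "\<bar>expect (P z x) (gen f) - gen f x\<bar> \<le> 2 * (2 * B * L) * L * h" .
  have "expect (P h x) f - step h f x = h * (expect (P z x) (gen f) - gen f x)"
    using z(3) by (simp add: step_def algebra_simps)
  also have "\<bar>\<dots>\<bar> \<le> h * (2 * (2 * B * L) * L * h)"
    using * hp by (simp add: abs_mult mult_left_mono del: mult_le_cancel_left_pos)
  finally show ?thesis by (simp add: power2_eq_square mult_ac)
qed

text \<open>For \<open>h * L \<le> 1\<close> the Euler step is an average with weights
  \<open>1 - h * R\<close> and \<open>h * r x y\<close>, so it does not increase the supremum
  norm.\<close>

lemma step_bounded:
  assumes h: "h \<ge> 0" "h * L \<le> 1" and f: "\<And>y. \<bar>f y\<bar> \<le> B"
  shows "\<bar>step h f x\<bar> \<le> B"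
proof (cases "x \<in> S")
  case True
  define R where "R = (\<Sum>y\<in>nbs x. r x y)"
  have r0: "0 \<le> r x y" if "y \<in> nbs x" for y using rate_nonneg True that by auto
  have "h * R \<le> h * L" using exit_rate[OF True] h by (auto simp: R_def intro: mult_left_mono)
  then have hR: "0 \<le> 1 - h * R" using h by linarith
  have "step h f x = (1 - h * R) * f x + h * (\<Sum>y\<in>nbs x. r x y * f y)"
    using True by (simp add: step_def gen_def R_def right_diff_distrib sum_subtractf
        flip: sum_distrib_right) (simp add: algebra_simps)
  also have "\<bar>\<dots>\<bar> \<le> (1 - h * R) * B + h * (\<Sum>y\<in>nbs x. r x y * B)"
  proof -
    have 1: "\<bar>(1 - h * R) * f x\<bar> \<le> (1 - h * R) * B"
      using hR f[of x] by (simp add: abs_mult mult_left_mono)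
    have "\<bar>\<Sum>y\<in>nbs x. r x y * f y\<bar> \<le> (\<Sum>y\<in>nbs x. \<bar>r x y * f y\<bar>)" by (rule sum_abs)
    also have "\<dots> \<le> (\<Sum>y\<in>nbs x. r x y * B)"
      using r0 f by (intro sum_mono) (simp add: abs_mult mult_left_mono)
    finally have 2: "\<bar>h * (\<Sum>y\<in>nbs x. r x y * f y)\<bar> \<le> h * (\<Sum>y\<in>nbs x. r x y * B)"
      using h by (simp add: abs_mult mult_left_mono)
    show ?thesis using 1 2 by linarith
  qed
  also have "\<dots> = B"
    by (simp add: R_def flip: sum_distrib_right) (simp add: algebra_simps)
  finally show ?thesis .
qed (use f in \<open>simp add: step_def gen_def\<close>)

lemma step_iterate_bounded:
  assumes "h \<ge> 0" "h * L \<le> 1" and "\<And>y. \<bar>f y\<bar> \<le> B"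
  shows "\<bar>(step h ^^ k) f x\<bar> \<le> B"
  using assms by (induction k arbitrary: x) (auto intro: step_bounded)

lemma euler_error:
  assumes h: "h \<ge> 0" "h * L \<le> 1" and f: "\<And>y. \<bar>f y\<bar> \<le> B" and x: "x \<in> S"
  shows "\<bar>expect (P (real k * h) x) f - (step h ^^ k) f x\<bar> \<le> real k * (4 * B * L\<^sup>2 * h\<^sup>2)"
  using x
proof (induction k arbitrary: x)
  case 0
  then show ?case using P_0 by simp
next
  case (Suc k)
  let ?g = "(step h ^^ k) f" and ?u = "\<lambda>y. expect (P (real k * h) y) f"
  have g: "\<bar>?g y\<bar> \<le> B" for y by (rule step_iterate_bounded[OF h f])
  have u: "\<bar>?u y\<bar> \<le> B" for y by (rule expect_abs_le[OF f])
  have "expect (P (real (Suc k) * h) x) f = expect (P h x) ?u"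
    using expect_P_add[of h "real k * h" x f B] h f Suc.prems by (simp add: algebra_simps)
  then have "expect (P (real (Suc k) * h) x) f - expect (P h x) ?g = expect (P h x) (\<lambda>y. ?u y - ?g y)"
    using g u by (simp add: integrable_pmf_bounded[where B=B])
  moreover have "\<bar>expect (P h x) (\<lambda>y. ?u y - ?g y)\<bar> \<le> real k * (4 * B * L\<^sup>2 * h\<^sup>2)"
    by (rule expect_abs_le, rule Suc.IH) (use set_P[OF h(1) Suc.prems] in auto)
  moreover have "\<bar>expect (P h x) ?g - step h ?g x\<bar> \<le> 4 * B * L\<^sup>2 * h\<^sup>2"
    by (rule expect_P_second_order[OF h(1) Suc.prems g])
  ultimately show ?case by (simp add: algebra_simps)
qed

lemma euler_limit:
  assumes t: "t \<ge> 0" and f: "\<And>y. \<bar>f y\<bar> \<le> B" and x: "x \<in> S"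
  shows "(\<lambda>k. (step (t / real k) ^^ k) f x) \<longlonglongrightarrow> expect (P t x) f"
    and "\<forall>\<^sub>F k in sequentially. t / real k * L \<le> 1"
proof -
  obtain M :: nat where M: "t * L < real M" using reals_Archimedean2 by blast
  have small: "t / real k * L \<le> 1" if "k \<ge> Suc M" for k
    using M that by (simp add: field_simps)
  then show "\<forall>\<^sub>F k in sequentially. t / real k * L \<le> 1"
    by (intro eventually_sequentiallyI)
  have "(\<lambda>k. (step (t / real k) ^^ k) f x - expect (P t x) f) \<longlonglongrightarrow> 0"
  proof (rule tendsto_rabs_zero_cancel, rule tendsto_sandwich[OF _ _ tendsto_const])
    show "(\<lambda>k. 4 * B * L\<^sup>2 * t\<^sup>2 / real k) \<longlonglongrightarrow> 0"
      by (rule tendsto_divide_0[OF tendsto_const]) (rule filterlim_at_top_imp_at_infinity[OF filterlim_real_sequentially])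
    show "\<forall>\<^sub>F k in sequentially. \<bar>(step (t / real k) ^^ k) f x - expect (P t x) f\<bar> \<le> 4 * B * L\<^sup>2 * t\<^sup>2 / real k"
    proof (rule eventually_sequentiallyI)
      fix k assume k: "k \<ge> Suc M"
      have "\<bar>expect (P (real k * (t / real k)) x) f - (step (t / real k) ^^ k) f x\<bar>
         \<le> real k * (4 * B * L\<^sup>2 * (t / real k)\<^sup>2)"
        using t by (intro euler_error small k f x) auto
      then show "\<bar>(step (t / real k) ^^ k) f x - expect (P t x) f\<bar> \<le> 4 * B * L\<^sup>2 * t\<^sup>2 / real k"
        using k by (simp add: power_divide power2_eq_square abs_minus_commute)
    qed
  qed auto
  then show "(\<lambda>k. (step (t / real k) ^^ k) f x) \<longlonglongrightarrow> expect (P t x) f"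
    by (rule Lim_null[THEN iffD2])
qed

text \<open>Only right difference quotients occur, so time 0 is included. For the chain started
  empty this inequality takes the place of the stationary balance equation.\<close>

lemma expect_P_gen_nonneg:
  assumes t: "t \<ge> 0" and x: "x \<in> S" and f: "\<And>y. \<bar>f y\<bar> \<le> B"
    and mono: "\<And>h. h > 0 \<Longrightarrow> expect (P t x) f \<le> expect (P (t + h) x) f"
  shows "0 \<le> expect (P t x) (gen f)"
proof (rule tendsto_lowerbound[OF quot_tendsto[OF set_P[OF t x] f]])
  show "\<forall>\<^sub>F h in at_right 0. 0 \<le> expect (P t x) (quot h f)"
    using eventually_at_right_less[of 0]
    by eventually_elim (use expect_quot[OF t _ x f] mono in simp)
qed simp

lemma stationary_expect_P:
  assumes "stationary_distribution S P \<pi>" and "t \<ge> 0" and "\<And>y. \<bar>f y\<bar> \<le> B"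
  shows "expect \<pi> (\<lambda>x. expect (P t x) f) = expect \<pi> f"
  using assms expect_bind[of f B \<pi> "P t"] by (simp add: stationary_distribution_def)

text \<open>Under a stationary law the expected quotient is 0 for every \<open>h > 0\<close>;
  dominated convergence carries this to the generator.\<close>

lemma stationary_gen:
  assumes st: "stationary_distribution S P \<pi>" and f: "\<And>y. \<bar>f y\<bar> \<le> B"
  shows "expect \<pi> (gen f) = 0"
proof (rule tendsto_unique[OF _ quot_tendsto[OF _ f]])
  show "set_pmf \<pi> \<subseteq> S" using st by (simp add: stationary_distribution_def)
  show "((\<lambda>h. expect \<pi> (quot h f)) \<longlongrightarrow> 0) (at_right 0)"
  proof (rule tendsto_eventually)
    show "\<forall>\<^sub>F h in at_right 0. expect \<pi> (quot h f) = 0"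
      using eventually_at_right_less[of 0]
    proof eventually_elim
      case (elim h)
      have f': "\<bar>expect (P h y) f\<bar> \<le> B" for y by (rule expect_abs_le[OF f])
      have "expect \<pi> (quot h f) = (expect \<pi> (\<lambda>y. expect (P h y) f) - expect \<pi> f) / h"
        unfolding quot_def using f f' by (simp add: integrable_pmf_bounded[where B=B])
      then show ?case using stationary_expect_P[OF st _ f] elim by simp
    qed
  qed
qed simp

end

section \<open>The generator of the parallel server system\<close>

locale parallel_servers =
  fixes n d :: nat and lam :: real and P :: "real \<Rightarrow> state \<Rightarrow> state pmf"
  assumes d_pos: "1 \<le> d" and d_le_n: "d \<le> n" and lam_pos: "0 < lam" and lam_less_1: "lam < 1"
    and tf: "transition_function (states n d) P"
    and jr: "has_jump_rates (states n d) (jump_rate n d lam) P"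
begin

abbreviation "CL \<equiv> classes n d"
abbreviation "ST \<equiv> states n d"
abbreviation "q \<equiv> queue n d"
abbreviation "arr \<equiv> arrival_rate n d lam"
abbreviation "dep \<equiv> departure_rate n d"

abbreviation inc :: "state \<Rightarrow> nat set \<Rightarrow> state" where
  "inc x c \<equiv> x(c := Suc (x c))"

abbreviation dec :: "state \<Rightarrow> nat set \<Rightarrow> state" where
  "dec x c \<equiv> x(c := x c - 1)"

text \<open>The form in which all drifts are computed: one arrival and one departure per class. For
  a class without jobs \<open>dec x c = x\<close> and the departure rate is 0.\<close>

definition model_gen :: "(state \<Rightarrow> real) \<Rightarrow> state \<Rightarrow> real" where
  "model_gen f x = (\<Sum>c\<in>CL. arr * (f (inc x c) - f x) + dep x c * (f (dec x c) - f x))"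

definition busy :: "state \<Rightarrow> real" where
  "busy x = (\<Sum>j=1..n. of_bool (0 < q x j))"

lemma n_pos: "0 < n"
  using d_pos d_le_n by simp

lemma finite_CL [simp]: "finite CL"
  unfolding classes_def by (rule finite_subset[of _ "Pow {1..n}"]) auto

lemma card_CL: "card CL = n choose d"
  using n_subsets[of "{1..n}" d] by (simp add: classes_def)

lemma choose_pos: "0 < n choose d"
  using d_le_n by simp

lemma arr_nonneg: "0 \<le> arr"
  using lam_pos by (simp add: arrival_rate_def)

lemma dep_nonneg: "0 \<le> dep x c"
  by (auto simp: departure_rate_def intro!: mult_nonneg_nonneg sum_nonneg)

lemma dep_0: "x c = 0 \<Longrightarrow> dep x c = 0"
  by (simp add: departure_rate_def)

lemma card_class: "c \<in> CL \<Longrightarrow> card c = d" and finite_class: "c \<in> CL \<Longrightarrow> finite c"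
  and class_server: "c \<in> CL \<Longrightarrow> j \<in> c \<Longrightarrow> j \<in> {1..n}"
  by (auto simp: classes_def intro: finite_subset)

lemma sum_classes_servers:
  fixes g :: "nat set \<Rightarrow> nat \<Rightarrow> real"
  shows "(\<Sum>c\<in>CL. \<Sum>j\<in>c. g c j) = (\<Sum>j=1..n. \<Sum>c | c \<in> CL \<and> j \<in> c. g c j)"
proof -
  have "(\<Sum>c\<in>CL. \<Sum>j\<in>c. g c j) = (\<Sum>c\<in>CL. \<Sum>j | j \<in> {1..n} \<and> j \<in> c. g c j)"
    by (intro sum.cong) (use class_server in auto)
  also have "\<dots> = (\<Sum>j=1..n. \<Sum>c | c \<in> CL \<and> j \<in> c. g c j)"
    by (rule sum.swap_restrict) auto
  finally show ?thesis .
qed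

lemma queue_real: "real (q x j) = (\<Sum>c | c \<in> CL \<and> j \<in> c. real (x c))"
  by (simp add: queue_def)

lemma le_queue: "c \<in> CL \<Longrightarrow> j \<in> c \<Longrightarrow> x c \<le> q x j"
  unfolding queue_def by (rule member_le_sum) auto

lemma queue_mono: "x \<le> y \<Longrightarrow> q x j \<le> q y j"
  unfolding queue_def by (rule sum_mono) (simp add: le_fun_def)

lemma queue_inc: "c \<in> CL \<Longrightarrow> q (inc x c) j = q x j + of_bool (j \<in> c)"
proof (cases "j \<in> c")
  case True
  assume c: "c \<in> CL"
  have "q (inc x c) j = inc x c c + (\<Sum>c'\<in>{c' \<in> CL. j \<in> c'} - {c}. inc x c c')"
    unfolding queue_def using c True by (subst sum.remove[of _ c]) auto
  also have "(\<Sum>c'\<in>{c' \<in> CL. j \<in> c'} - {c}. inc x c c') = (\<Sum>c'\<in>{c' \<in> CL. j \<in> c'} - {c}. x c')"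
    by (rule sum.cong) auto
  finally show ?thesis
    unfolding queue_def using c True by (subst sum.remove[of _ c]) auto
next
  case False
  then show ?thesis unfolding queue_def by (auto intro!: sum.cong)
qed

lemma queue_dec:
  assumes "c \<in> CL" "0 < x c" shows "q (dec x c) j + of_bool (j \<in> c) = q x j"
  using queue_inc[OF assms(1), of "dec x c" j] assms(2) by simp

text \<open>Each busy server hands out a total rate of 1 to its classes. At an idle server the
  quotient \<open>0 / 0\<close> is 0, which agrees with its contribution to
  \<open>busy\<close>.\<close>

lemma sum_dep: "(\<Sum>c\<in>CL. dep x c) = busy x"
proof -
  have "(\<Sum>c\<in>CL. dep x c) = (\<Sum>c\<in>CL. \<Sum>j\<in>c. real (x c) / real (q x j))"
    by (simp add: departure_rate_def sum_distrib_left)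
  also have "\<dots> = (\<Sum>j=1..n. real (q x j) / real (q x j))"
    unfolding sum_classes_servers by (simp only: queue_real sum_divide_distrib)
  also have "\<dots> = busy x"
    unfolding busy_def by (rule sum.cong) auto
  finally show ?thesis .
qed

lemma busy_nonneg: "0 \<le> busy x" and busy_le: "busy x \<le> real n"
proof -
  show "0 \<le> busy x" unfolding busy_def by (rule sum_nonneg) auto
  have "busy x \<le> (\<Sum>j=1..n. 1)" unfolding busy_def by (rule sum_mono) auto
  then show "busy x \<le> real n" by simp
qed

lemma sum_arr: "(\<Sum>c\<in>CL. arr) = real n * lam"
  using choose_pos by (simp add: card_CL arrival_rate_def)

text \<open>Arrivals at a given server have total rate \<open>lam * d\<close>, because
  \<open>d * (n choose d) = n * ((n - 1) choose (d - 1))\<close>; the dependence on \<open>n\<close>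
  cancels. The classes containing \<open>j\<close> are counted by removing \<open>j\<close>.\<close>

lemma card_classes_containing:
  assumes "j \<in> {1..n}"
  shows "real (card {c \<in> CL. j \<in> c}) * arr = lam * real d"
proof -
  have fin: "finite ({1..n} - {j})" by simp
  have "bij_betw (insert j) {c. c \<subseteq> {1..n} - {j} \<and> card c = d - 1} {c \<in> CL. j \<in> c}"
  proof (rule bij_betw_byWitness[where f'="\<lambda>c. c - {j}"])
    show "\<forall>c\<in>{c. c \<subseteq> {1..n} - {j} \<and> card c = d - 1}. insert j c - {j} = c" by auto
    show "\<forall>c\<in>{c \<in> CL. j \<in> c}. insert j (c - {j}) = c" by auto
    show "insert j ` {c. c \<subseteq> {1..n} - {j} \<and> card c = d - 1} \<subseteq> {c \<in> CL. j \<in> c}"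
    proof safe
      fix c assume c: "c \<subseteq> {1..n} - {j}" "card c = d - 1"
      have "finite c" using c(1) fin by (rule finite_subset)
      then have "card (insert j c) = d" using c d_pos by (subst card_insert_disjoint) auto
      then show "insert j c \<in> CL" using c assms by (auto simp: classes_def)
    qed
    show "(\<lambda>c. c - {j}) ` {c \<in> CL. j \<in> c} \<subseteq> {c. c \<subseteq> {1..n} - {j} \<and> card c = d - 1}"
      by (auto simp: classes_def card_Diff_singleton)
  qed
  then have "card {c \<in> CL. j \<in> c} = card {c. c \<subseteq> {1..n} - {j} \<and> card c = d - 1}"
    by (simp add: bij_betw_same_card)
  also have "\<dots> = (n - 1) choose (d - 1)"
    using n_subsets[OF fin, of "d - 1"] assms by simp
  finally have card: "card {c \<in> CL. j \<in> c} = (n - 1) choose (d - 1)" .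
  have "d * (n choose d) = n * ((n - 1) choose (d - 1))"
    using d_pos n_pos Suc_times_binomial_eq[of "n - 1" "d - 1"] by (cases n; cases d) (auto simp: mult_ac)
  then have "real d * real (n choose d) = real n * real ((n - 1) choose (d - 1))"
    by (metis of_nat_mult)
  then show ?thesis
    unfolding card arrival_rate_def using choose_pos by (simp add: field_simps)
qed

lemma inc_states: "x \<in> ST \<Longrightarrow> c \<in> CL \<Longrightarrow> inc x c \<in> ST"
  and dec_states: "x \<in> ST \<Longrightarrow> c \<in> CL \<Longrightarrow> dec x c \<in> ST"
  by (auto simp: states_def)

lemma jump_rate_nonneg: "0 \<le> jump_rate n d lam x y"
  unfolding jump_rate_def by (intro sum_nonneg) (simp add: arr_nonneg dep_nonneg)

lemma jump_rate_support:
  assumes "jump_rate n d lam x y \<noteq> 0"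
  shows "y \<in> inc x ` CL \<union> dec x ` CL"
proof (rule ccontr)
  assume y: "y \<notin> inc x ` CL \<union> dec x ` CL"
  have "jump_rate n d lam x y = 0"
    unfolding jump_rate_def by (rule sum.neutral) (use y in auto)
  with assms show False by simp
qed

text \<open>The jump rates are themselves sums over classes, so exchanging two sums gives one term
  per class. The condition \<open>g x = 0\<close> takes care of the state \<open>x\<close> itself,
  which \<open>dec x c\<close> equals when the class is empty.\<close>

lemma sum_jump_rate:
  assumes x: "x \<in> ST" and g: "g x = 0"
  shows "(\<Sum>y\<in>{y \<in> ST - {x}. jump_rate n d lam x y \<noteq> 0}. jump_rate n d lam x y * g y)
       = (\<Sum>c\<in>CL. arr * g (inc x c) + dep x c * g (dec x c))"
proof -
  let ?N = "inc x ` CL \<union> dec x ` CL"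
  have "(\<Sum>y\<in>{y \<in> ST - {x}. jump_rate n d lam x y \<noteq> 0}. jump_rate n d lam x y * g y)
      = (\<Sum>y\<in>?N. jump_rate n d lam x y * g y)"
  proof (rule sum.mono_neutral_left)
    show "{y \<in> ST - {x}. jump_rate n d lam x y \<noteq> 0} \<subseteq> ?N"
      using jump_rate_support by auto
    have "?N \<subseteq> ST" using inc_states[OF x] dec_states[OF x] by auto
    then show "\<forall>y\<in>?N - {y \<in> ST - {x}. jump_rate n d lam x y \<noteq> 0}. jump_rate n d lam x y * g y = 0"
      using g by auto
  qed simp
  also have "\<dots> = (\<Sum>y\<in>?N. \<Sum>c\<in>CL. (if y = inc x c then arr * g y else 0)
      + (if y = dec x c then dep x c * g y else 0))"
    unfolding jump_rate_def sum_distrib_right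
    by (intro sum.cong refl) (auto simp: dep_0 distrib_right)
  also have "\<dots> = (\<Sum>c\<in>CL. \<Sum>y\<in>?N. (if y = inc x c then arr * g y else 0)
      + (if y = dec x c then dep x c * g y else 0))"
    by (rule sum.swap)
  also have "\<dots> = (\<Sum>c\<in>CL. arr * g (inc x c) + dep x c * g (dec x c))"
    by (rule sum.cong) (auto simp: sum.distrib)
  finally show ?thesis .
qed

text \<open>Arrivals have total rate \<open>n * lam\<close>; departures have total rate
  \<open>busy x\<close>, at most \<open>n\<close>.\<close>

abbreviation rate_bound :: real where
  "rate_bound \<equiv> real n * (lam + 1)"

sublocale bounded_jump_semigroup ST "jump_rate n d lam" P rate_bound
proof
  fix x :: state assume x: "x \<in> ST"
  show "finite {y \<in> ST - {x}. jump_rate n d lam x y \<noteq> 0}"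
    by (rule finite_subset[of _ "inc x ` CL \<union> dec x ` CL"]) (use jump_rate_support in auto)
  have "(\<Sum>y\<in>{y \<in> ST - {x}. jump_rate n d lam x y \<noteq> 0}. jump_rate n d lam x y)
      = (\<Sum>y\<in>{y \<in> ST - {x}. jump_rate n d lam x y \<noteq> 0}. jump_rate n d lam x y * of_bool (y \<noteq> x))"
    by (rule sum.cong) auto
  also have "\<dots> = (\<Sum>c\<in>CL. arr * of_bool (inc x c \<noteq> x) + dep x c * of_bool (dec x c \<noteq> x))"
    by (rule sum_jump_rate[OF x]) simp
  also have "\<dots> \<le> (\<Sum>c\<in>CL. arr + dep x c)"
    using arr_nonneg dep_nonneg by (intro sum_mono add_mono) auto
  also have "\<dots> = real n * lam + busy x"
    using sum_arr by (simp add: sum.distrib sum_dep)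
  also have "\<dots> \<le> rate_bound"
    using busy_le by (simp add: algebra_simps)
  finally show "(\<Sum>y\<in>{y \<in> ST - {x}. jump_rate n d lam x y \<noteq> 0}. jump_rate n d lam x y) \<le> rate_bound" .
next
  show "0 < rate_bound" using n_pos lam_pos by simp
qed (simp_all add: tf jr jump_rate_nonneg)

lemma gen_eq: "x \<in> ST \<Longrightarrow> gen f x = model_gen f x"
  unfolding gen_def model_gen_def by (simp only: if_True) (rule sum_jump_rate, auto)

section \<open>Monotonicity\<close>

lemma dep_antimono:
  assumes "c \<in> CL" "x \<le> y" "x c = y c"
  shows "dep y c \<le> dep x c"
proof (cases "x c = 0")
  case True
  then show ?thesis using assms by (simp add: departure_rate_def)
next
  case False
  have "1 / real (q y j) \<le> 1 / real (q x j)" if "j \<in> c" for j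
    using le_queue[OF assms(1) that, of x] queue_mono[OF assms(2), of j] False
    by (intro divide_left_mono) auto
  then show ?thesis
    using assms(3) by (auto simp: departure_rate_def intro!: mult_left_mono sum_mono)
qed

text \<open>
  Classwise comparison: if \<open>x c < y c\<close>, a departure from \<open>y\<close> keeps it above \<open>x\<close>; if
  \<open>x c = y c\<close>, the departure rate in \<open>x\<close> is at least the one in \<open>y\<close>.
\<close>

lemma model_gen_mono:
  assumes f: "mono_on ST f" and x: "x \<in> ST" and y: "y \<in> ST" and xy: "x \<le> y"
  shows "model_gen f x - model_gen f y \<le> rate_bound * (f y - f x)"
proof -
  have fxy: "f x \<le> f y" using f x y xy by (rule mono_onD)
  have le: "(arr * (f (inc x c) - f x) + dep x c * (f (dec x c) - f x))
      - (arr * (f (inc y c) - f y) + dep y c * (f (dec y c) - f y)) \<le> (arr + dep y c) * (f y - f x)"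
    if c: "c \<in> CL" for c
  proof -
    have "f (inc x c) \<le> f (inc y c)"
      by (rule mono_onD[OF f]) (use inc_states x y c xy in \<open>auto simp: le_fun_def\<close>)
    then have 1: "arr * f (inc x c) \<le> arr * f (inc y c)"
      using arr_nonneg by (rule mult_left_mono)
    have fx: "f (dec x c) \<le> f x"
      by (rule mono_onD[OF f]) (use dec_states x c in \<open>auto simp: le_fun_def\<close>)
    have 2: "dep x c * (f (dec x c) - f x) - dep y c * (f (dec y c) - f y) \<le> dep y c * (f y - f x)"
    proof (cases "x c = y c")
      case True
      have "f (dec x c) \<le> f (dec y c)"
        by (rule mono_onD[OF f]) (use dec_states x y c xy in \<open>auto simp: le_fun_def diff_le_mono\<close>)
      then have "dep y c * f (dec x c) \<le> dep y c * f (dec y c)"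
        using dep_nonneg by (rule mult_left_mono)
      moreover have "dep y c * (f x - f (dec x c)) \<le> dep x c * (f x - f (dec x c))"
        using dep_antimono[OF c xy True] fx by (intro mult_right_mono) auto
      ultimately show ?thesis by (simp add: algebra_simps)
    next
      case False
      with xy have "x c < y c" by (simp add: le_fun_def order.strict_iff_order)
      then have "f x \<le> f (dec y c)"
        by (intro mono_onD[OF f]) (use dec_states x y c xy in \<open>auto simp: le_fun_def\<close>)
      then have "dep y c * f x \<le> dep y c * f (dec y c)"
        using dep_nonneg by (rule mult_left_mono)
      moreover have "dep x c * f (dec x c) \<le> dep x c * f x"
        using fx dep_nonneg by (rule mult_left_mono)
      ultimately show ?thesis by (simp add: algebra_simps)
    qed
    show ?thesis using 1 2 by (simp add: algebra_simps)
  qed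
  have "model_gen f x - model_gen f y \<le> (\<Sum>c\<in>CL. (arr + dep y c) * (f y - f x))"
    unfolding model_gen_def sum_subtractf[symmetric] by (rule sum_mono) (rule le)
  also have "\<dots> = (real n * lam + busy y) * (f y - f x)"
    unfolding sum_distrib_right[symmetric] sum.distrib sum_dep sum_arr ..
  also have "\<dots> \<le> rate_bound * (f y - f x)"
    using busy_le[of y] fxy by (intro mult_right_mono) (auto simp: algebra_simps)
  finally show ?thesis .
qed

text \<open>The slack \<open>rate_bound * (f y - f x)\<close> in the comparison of generators is
  absorbed by the identity part of the step when \<open>h * rate_bound \<le> 1\<close>.\<close>

lemma step_mono:
  assumes h: "0 \<le> h" "h * rate_bound \<le> 1" and f: "mono_on ST f"
  shows "mono_on ST (step h f)"
proof (rule mono_onI)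
  fix x y assume xy: "x \<in> ST" "y \<in> ST" "x \<le> y"
  have "h * (model_gen f x - model_gen f y) \<le> h * (rate_bound * (f y - f x))"
    by (intro mult_left_mono model_gen_mono f xy h)
  also have "\<dots> \<le> f y - f x"
    using mult_right_mono[OF h(2), of "f y - f x"] mono_onD[OF f xy] by (simp add: mult.assoc)
  finally show "step h f x \<le> step h f y"
    using xy by (simp add: step_def gen_eq algebra_simps)
qed

lemma expect_P_mono:
  assumes t: "0 \<le> t" and f: "mono_on ST f" "\<And>y. \<bar>f y\<bar> \<le> B" and xy: "x \<in> ST" "y \<in> ST" "x \<le> y"
  shows "expect (P t x) f \<le> expect (P t y) f"
proof (rule tendsto_le[OF _ euler_limit(1)[OF t f(2) xy(2)] euler_limit(1)[OF t f(2) xy(1)]])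
  have it: "mono_on ST ((step h ^^ k) f)" if "0 \<le> h" "h * rate_bound \<le> 1" for h k
    using step_mono[OF that] f(1) by (induction k) auto
  show "\<forall>\<^sub>F k in sequentially. (step (t / real k) ^^ k) f x \<le> (step (t / real k) ^^ k) f y"
    using euler_limit(2)[OF t f(2) xy(1)]
    by eventually_elim (rule mono_onD[OF it], use t xy in auto)
qed simp

abbreviation empty_state :: state where
  "empty_state \<equiv> \<lambda>_. 0"

lemma empty_state [simp]: "empty_state \<in> ST"
  by (simp add: states_def)

text \<open>The empty state lies below every state. With \<open>p\<close> stationary this bounds the
  transient chain by equilibrium; with \<open>p\<close> the law at a time \<open>h\<close> it yields
  monotonicity in time.\<close>

lemma expect_P_empty_le:
  assumes t: "0 \<le> t" and f: "mono_on ST f" "\<And>y. \<bar>f y\<bar> \<le> B" and p: "set_pmf p \<subseteq> ST"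
  shows "expect (P t empty_state) f \<le> expect p (\<lambda>x. expect (P t x) f)"
proof -
  have "expect p (\<lambda>_. expect (P t empty_state) f) \<le> expect p (\<lambda>x. expect (P t x) f)"
  proof (rule expect_mono[where B=B and C=B])
    show "expect (P t empty_state) f \<le> expect (P t y) f" if "y \<in> set_pmf p" for y
      by (rule expect_P_mono[OF t f]) (use p that in \<open>auto simp: le_fun_def\<close>)
  qed (rule expect_abs_le[OF f(2)])+
  then show ?thesis by simp
qed

lemma expect_empty_mono_time:
  assumes t: "0 \<le> t" "0 \<le> h" and f: "mono_on ST f" "\<And>y. \<bar>f y\<bar> \<le> B"
  shows "expect (P t empty_state) f \<le> expect (P (t + h) empty_state) f"
proof -
  have "expect (P (h + t) empty_state) f = expect (P h empty_state) (\<lambda>y. expect (P t y) f)"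
    by (rule expect_P_add[OF t(2,1) empty_state f(2)])
  then show ?thesis
    using expect_P_empty_le[OF t(1) f, of "P h empty_state"] set_P[OF t(2) empty_state]
    by (simp add: add.commute)
qed

section \<open>Exchangeability of the servers\<close>

context
  fixes \<sigma> :: "nat \<Rightarrow> nat"
  assumes invol: "\<And>k. \<sigma> (\<sigma> k) = k" and range: "\<sigma> ` {1..n} = {1..n}"
begin

text \<open>For an involution, image and preimage under \<sigma> coincide, so relabelling is its own
  inverse. Exchanging two servers is of this kind.\<close>

definition relabel :: "state \<Rightarrow> state" where
  "relabel x = (\<lambda>c. x (\<sigma> ` c))"

lemma image_invol [simp]: "\<sigma> ` (\<sigma> ` c) = c"
  by (simp add: image_image invol)

lemma inj_sigma: "inj_on \<sigma> A"
  by (metis invol inj_onI)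

lemma image_in_CL: "\<sigma> ` c \<in> CL \<longleftrightarrow> c \<in> CL"
proof -
  have "\<sigma> ` c \<in> CL" if "c \<in> CL" for c
    using that range image_mono[of c "{1..n}" \<sigma>] by (simp add: classes_def card_image inj_sigma)
  from this[of c] this[of "\<sigma> ` c"] show ?thesis by auto
qed

lemma relabel_in_ST: "relabel x \<in> ST \<longleftrightarrow> x \<in> ST"
proof -
  have "relabel x \<in> ST" if "x \<in> ST" for x
    using that by (simp add: states_def relabel_def image_in_CL)
  moreover have "relabel (relabel x) = x" by (simp add: relabel_def)
  ultimately show ?thesis by metis
qed

lemma relabel_upd: "relabel (x(\<sigma> ` c := v)) = (relabel x)(c := v)"
proof
  fix c'
  have "\<sigma> ` c' = \<sigma> ` c \<longleftrightarrow> c' = c" by (metis image_invol)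
  then show "relabel (x(\<sigma> ` c := v)) c' = ((relabel x)(c := v)) c'"
    by (simp add: relabel_def)
qed

lemma mem_image: "j \<in> \<sigma> ` c \<longleftrightarrow> \<sigma> j \<in> c"
  by (metis invol image_iff)

lemma queue_relabel: "q (relabel x) j = q x (\<sigma> j)"
  unfolding queue_def relabel_def
  by (rule sum.reindex_bij_witness[of _ "image \<sigma>" "image \<sigma>"]) (auto simp: image_in_CL mem_image invol)

lemma dep_relabel: "dep (relabel x) c = dep x (\<sigma> ` c)"
  by (simp add: departure_rate_def queue_relabel sum.reindex inj_sigma) (simp add: relabel_def)

lemma model_gen_relabel: "model_gen (\<lambda>x. f (relabel x)) x = model_gen f (relabel x)"
  unfolding model_gen_def
proof (rule sum.reindex_bij_witness[of _ "image \<sigma>" "image \<sigma>"])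
  fix c
  have "inc (relabel x) (\<sigma> ` c) = relabel (inc x c)" "dec (relabel x) (\<sigma> ` c) = relabel (dec x c)"
    using relabel_upd[of x "\<sigma> ` c"] by (simp_all add: relabel_def)
  then show "arr * (f (inc (relabel x) (\<sigma> ` c)) - f (relabel x))
      + dep (relabel x) (\<sigma> ` c) * (f (dec (relabel x) (\<sigma> ` c)) - f (relabel x))
    = arr * (f (relabel (inc x c)) - f (relabel x)) + dep x c * (f (relabel (dec x c)) - f (relabel x))"
    by (simp add: dep_relabel)
qed (auto simp: image_in_CL)

lemma step_relabel: "step h (\<lambda>x. f (relabel x)) = (\<lambda>x. step h f (relabel x))"
proof
  fix x
  show "step h (\<lambda>x. f (relabel x)) x = step h f (relabel x)"
    by (cases "x \<in> ST") (auto simp: step_def gen_eq relabel_in_ST model_gen_relabel, simp_all add: gen_def relabel_in_ST)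
qed

text \<open>Symmetry is checked on the Euler iterates: a step commutes with relabelling, and the
  empty state is fixed by it. The rates thus pass their symmetry to the law without a uniqueness
  theorem for the semigroup.\<close>

lemma expect_relabel:
  assumes t: "0 \<le> t" and f: "\<And>y. \<bar>f y\<bar> \<le> B"
  shows "expect (P t empty_state) (\<lambda>x. f (relabel x)) = expect (P t empty_state) f"
proof (rule LIMSEQ_unique)
  have "(step h ^^ k) (\<lambda>x. f (relabel x)) = (\<lambda>x. (step h ^^ k) f (relabel x))" for h k
    by (induction k) (simp_all add: step_relabel)
  then have eq: "(step h ^^ k) (\<lambda>x. f (relabel x)) empty_state = (step h ^^ k) f empty_state" for h k
    by (simp add: relabel_def)
  show "(\<lambda>k. (step (t / real k) ^^ k) f empty_state) \<longlonglongrightarrow> expect (P t empty_state) (\<lambda>x. f (relabel x))"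
    unfolding eq[symmetric] by (rule euler_limit(1)[OF t f empty_state])
  show "(\<lambda>k. (step (t / real k) ^^ k) f empty_state) \<longlonglongrightarrow> expect (P t empty_state) f"
    by (rule euler_limit(1)[OF t f empty_state])
qed

end

lemma expect_empty_exchangeable:
  fixes g :: "nat \<Rightarrow> real"
  assumes t: "0 \<le> t" and i: "i \<in> {1..n}" and j: "j \<in> {1..n}" and g: "\<And>k. \<bar>g k\<bar> \<le> B"
  shows "expect (P t empty_state) (\<lambda>x. g (q x i)) = expect (P t empty_state) (\<lambda>x. g (q x j))"
proof -
  define \<sigma> where "\<sigma> k = (if k = i then j else if k = j then i else k)" for k
  have inv: "\<sigma> (\<sigma> k) = k" for k by (simp add: \<sigma>_def)
  have "\<sigma> ` {1..n} \<subseteq> {1..n}" using i j by (auto simp: \<sigma>_def)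
  moreover from this have "{1..n} \<subseteq> \<sigma> ` {1..n}" by (metis image_mono image_invol[OF inv] image_subset_iff inv subset_eq rev_image_eqI)
  ultimately have rng: "\<sigma> ` {1..n} = {1..n}" by simp
  have "expect (P t empty_state) (\<lambda>x. g (q (relabel \<sigma> x) j)) = expect (P t empty_state) (\<lambda>x. g (q x j))"
    by (rule expect_relabel[OF inv rng t]) (rule g)
  then show ?thesis
    using queue_relabel[OF inv rng] by (cases "i = j") (simp_all add: \<sigma>_def)
qed

end

text \<open>Cauchy-Schwarz. For the queues of a class it shows that long queues, which slow down its
  departures, are compensated by the larger decrease of the squares.\<close>

lemma sum_times_sum_inverse_ge:
  fixes g :: "'a \<Rightarrow> real"
  assumes "\<And>j. j \<in> c \<Longrightarrow> 0 < g j"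
  shows "(real (card c))\<^sup>2 \<le> (\<Sum>j\<in>c. 1 / g j) * (\<Sum>j\<in>c. g j)"
proof -
  have "(\<Sum>j\<in>c. sqrt (1 / g j) * sqrt (g j))\<^sup>2 \<le> (\<Sum>j\<in>c. (sqrt (1 / g j))\<^sup>2) * (\<Sum>j\<in>c. (sqrt (g j))\<^sup>2)"
    by (rule Cauchy_Schwarz_ineq_sum)
  moreover have "(\<Sum>j\<in>c. sqrt (1 / g j) * sqrt (g j)) = real (card c)"
    using assms by (simp add: real_sqrt_divide less_imp_neq[symmetric])
  moreover have "(\<Sum>j\<in>c. (sqrt (1 / g j))\<^sup>2) = (\<Sum>j\<in>c. 1 / g j)" "(\<Sum>j\<in>c. (sqrt (g j))\<^sup>2) = (\<Sum>j\<in>c. g j)"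
    using assms by (simp_all add: less_imp_le)
  ultimately show ?thesis by simp
qed

text \<open>Bounds the stationary mean queue per server: the constant
  \<open>d * n * (1 + lam)\<close> in the drift of the squared queues, divided by the coefficient
  \<open>2 * d * (1 - lam)\<close> and by \<open>n\<close>.\<close>

definition mean_queue_bound :: "real \<Rightarrow> real" where
  "mean_queue_bound lam = (1 + lam) / (2 * (1 - lam))"

text \<open>The product of the factors relating the tail gaps at consecutive levels; free of
  \<open>n\<close>.\<close>

definition tail_factor :: "nat \<Rightarrow> real \<Rightarrow> nat \<Rightarrow> real" where
  "tail_factor d lam k = (\<Prod>i<k. real d * (real (Suc i) + lam))"

context parallel_servers
begin

section \<open>Drift of some functions of the queue lengths\<close>

text \<open>Each job is counted once per server of its class, so this is \<open>d\<close> times the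
  number of jobs and moves in jumps of size \<open>d\<close>.\<close>

definition total_queue :: "state \<Rightarrow> real" where
  "total_queue x = (\<Sum>j=1..n. real (q x j))"

definition sum_squares :: "state \<Rightarrow> real" where
  "sum_squares x = (\<Sum>j=1..n. (real (q x j))\<^sup>2)"

text \<open>The rate at which the queue at \<open>j\<close> shrinks. It includes work by other
  servers on jobs that also wait at \<open>j\<close>, so it can exceed 1 and is in general not a
  function of the queue at \<open>j\<close>.\<close>

definition service_rate :: "nat \<Rightarrow> state \<Rightarrow> real" where
  "service_rate j x = (\<Sum>c | c \<in> CL \<and> j \<in> c. dep x c)"

lemma sum_over_class:
  fixes g :: "nat \<Rightarrow> real"
  assumes "c \<in> CL"
  shows "(\<Sum>j=1..n. of_bool (j \<in> c) * g j) = (\<Sum>j\<in>c. g j)"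
proof -
  have "(\<Sum>j=1..n. of_bool (j \<in> c) * g j) = (\<Sum>j\<in>c. of_bool (j \<in> c) * g j)"
    using assms by (intro sum.mono_neutral_right) (auto simp: classes_def)
  then show ?thesis by simp
qed

lemma sum_queues_inc:
  fixes g :: "nat \<Rightarrow> real"
  assumes "c \<in> CL"
  shows "(\<Sum>j=1..n. g (q (inc x c) j)) - (\<Sum>j=1..n. g (q x j)) = (\<Sum>j\<in>c. g (q x j + 1) - g (q x j))"
  unfolding sum_over_class[OF assms, symmetric] sum_subtractf[symmetric]
  by (rule sum.cong) (simp_all add: queue_inc assms)

lemma sum_queues_dec:
  fixes g :: "nat \<Rightarrow> real"
  assumes "c \<in> CL" "0 < x c"
  shows "(\<Sum>j=1..n. g (q (dec x c) j)) - (\<Sum>j=1..n. g (q x j)) = (\<Sum>j\<in>c. g (q x j - 1) - g (q x j))"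
  unfolding sum_over_class[OF assms(1), symmetric] sum_subtractf[symmetric]
proof (rule sum.cong)
  fix j
  have "q (dec x c) j = q x j - of_bool (j \<in> c)"
    using queue_dec[where c=c and x=x and j=j, OF assms] by simp
  then show "g (q (dec x c) j) - g (q x j) = of_bool (j \<in> c) * (g (q x j - 1) - g (q x j))"
    by simp
qed simp

lemma queue_pos: "c \<in> CL \<Longrightarrow> 0 < x c \<Longrightarrow> j \<in> c \<Longrightarrow> 0 < q x j"
  by (rule less_le_trans[OF _ le_queue])

lemma total_queue_inc: "c \<in> CL \<Longrightarrow> total_queue (inc x c) = total_queue x + real d"
  using sum_queues_inc[of c real x] card_class[of c] by (simp add: total_queue_def)

lemma total_queue_dec:
  assumes "c \<in> CL" "0 < x c"
  shows "total_queue (dec x c) = total_queue x - real d"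
proof -
  have "total_queue (dec x c) - total_queue x = (\<Sum>j\<in>c. -1)"
    unfolding total_queue_def sum_queues_dec[where c=c and x=x, OF assms]
  proof (rule sum.cong)
    fix j assume "j \<in> c"
    then show "real (q x j - 1) - real (q x j) = - 1"
      using queue_pos[where c=c and x=x and j=j, OF assms] by (simp add: of_nat_diff)
  qed simp
  then show ?thesis using card_class[OF assms(1)] by simp
qed

lemma total_queue_nonneg: "0 \<le> total_queue x"
  by (simp add: total_queue_def sum_nonneg)

lemma total_queue_le_sum_squares: "total_queue x \<le> sum_squares x"
proof -
  have "real k \<le> (real k)\<^sup>2" for k :: nat
    by (metis of_nat_le_iff of_nat_power le_square power2_eq_square)
  then show ?thesis unfolding total_queue_def sum_squares_def by (intro sum_mono)
qed

lemma total_queue_mono: "x \<le> y \<Longrightarrow> total_queue x \<le> total_queue y"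
  unfolding total_queue_def by (intro sum_mono) (simp add: queue_mono)

lemma total_queue_empty [simp]: "total_queue empty_state = 0"
  by (simp add: total_queue_def queue_def)

lemma sum_classes_total_queue: "(\<Sum>c\<in>CL. real (x c)) * real d = total_queue x"
proof -
  have "(\<Sum>c\<in>CL. real (x c)) * real d = (\<Sum>c\<in>CL. \<Sum>j\<in>c. real (x c))"
    by (simp add: sum_distrib_left card_class mult.commute)
  also have "\<dots> = total_queue x"
    unfolding sum_classes_servers total_queue_def queue_real ..
  finally show ?thesis .
qed

text \<open>Arrivals contribute \<open>2 * d * lam\<close> times the total queue, departures at most
  \<open>- 2 * d\<close> times it, and the remaining terms are of order \<open>d * n\<close>; hence
  the factor \<open>1 - lam\<close>.\<close>

lemma model_gen_sum_squares_le: "model_gen sum_squares x \<le> real d * real n * (1 + lam) - 2 * real d * (1 - lam) * total_queue x"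
proof -
  have up: "sum_squares (inc x c) - sum_squares x = (\<Sum>j\<in>c. 2 * real (q x j) + 1)" if "c \<in> CL" for c
    unfolding sum_squares_def sum_queues_inc[OF that, of "\<lambda>k. (real k)\<^sup>2"]
    by (rule sum.cong) (simp_all add: power2_eq_square algebra_simps)
  have down: "dep x c * (sum_squares (dec x c) - sum_squares x) \<le> real d * dep x c - 2 * (real d)\<^sup>2 * real (x c)"
    if c: "c \<in> CL" for c
  proof (cases "x c = 0")
    case True
    then show ?thesis by (simp add: dep_0)
  next
    case False
    then have xc: "0 < x c" by simp
    have "sum_squares (dec x c) - sum_squares x = (\<Sum>j\<in>c. 1 - 2 * real (q x j))"
      unfolding sum_squares_def sum_queues_dec[where c=c and x=x and g="\<lambda>k. (real k)\<^sup>2", OF c xc]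
    proof (rule sum.cong)
      fix j assume "j \<in> c"
      then have "real (q x j - 1) = real (q x j) - 1"
        using queue_pos[where c=c and x=x and j=j, OF c xc] by (simp add: of_nat_diff)
      then show "(real (q x j - 1))\<^sup>2 - (real (q x j))\<^sup>2 = 1 - 2 * real (q x j)"
        by (simp add: power2_eq_square algebra_simps)
    qed simp
    then have diff: "sum_squares (dec x c) - sum_squares x = real d - 2 * (\<Sum>j\<in>c. real (q x j))"
      by (simp add: card_class c sum_subtractf sum_distrib_left)
    have "dep x c * (sum_squares (dec x c) - sum_squares x) = real d * dep x c - 2 * (dep x c * (\<Sum>j\<in>c. real (q x j)))"
      unfolding diff by (simp add: algebra_simps)
    \<comment> \<open>The departure rate contains the sum of the \<open>1 / q x j\<close>, the
      decrease of the squares the sum of the \<open>q x j\<close>; their product is at least the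
      square of \<open>d\<close>, whatever the queues are.\<close>
    moreover have "real (x c) * (real d)\<^sup>2 \<le> real (x c) * ((\<Sum>j\<in>c. 1 / real (q x j)) * (\<Sum>j\<in>c. real (q x j)))"
      using sum_times_sum_inverse_ge[of c "\<lambda>j. real (q x j)"] queue_pos[where c=c and x=x, OF c xc]
      by (intro mult_left_mono) (auto simp: card_class c)
    ultimately show ?thesis by (simp add: departure_rate_def mult_ac)
  qed
  have "model_gen sum_squares x \<le> (\<Sum>c\<in>CL. arr * (\<Sum>j\<in>c. 2 * real (q x j) + 1)
      + (real d * dep x c - 2 * (real d)\<^sup>2 * real (x c)))"
    unfolding model_gen_def
  proof (intro sum_mono add_mono)
    fix c assume c: "c \<in> CL"
    show "arr * (sum_squares (inc x c) - sum_squares x) \<le> arr * (\<Sum>j\<in>c. 2 * real (q x j) + 1)"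
      by (simp add: up c)
    show "dep x c * (sum_squares (dec x c) - sum_squares x) \<le> real d * dep x c - 2 * (real d)\<^sup>2 * real (x c)"
      by (rule down[OF c])
  qed
  also have "\<dots> = (\<Sum>c\<in>CL. arr * (\<Sum>j\<in>c. 2 * real (q x j) + 1)) + real d * busy x
      - 2 * (real d)\<^sup>2 * (\<Sum>c\<in>CL. real (x c))"
    by (simp add: sum.distrib sum_subtractf sum_dep flip: sum_distrib_left)
  also have "(\<Sum>c\<in>CL. arr * (\<Sum>j\<in>c. 2 * real (q x j) + 1)) = (\<Sum>c\<in>CL. \<Sum>j\<in>c. arr * (2 * real (q x j) + 1))"
    by (simp add: sum_distrib_left)
  also have "\<dots> = (\<Sum>j=1..n. (real (card {c \<in> CL. j \<in> c}) * arr) * (2 * real (q x j) + 1))"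
    unfolding sum_classes_servers by (simp add: mult.assoc)
  also have "\<dots> = (\<Sum>j=1..n. lam * real d * (2 * real (q x j) + 1))"
    by (rule sum.cong) (simp_all add: card_classes_containing)
  also have "\<dots> = lam * real d * (2 * total_queue x + real n)"
    unfolding sum_distrib_left[symmetric] total_queue_def by (simp add: sum.distrib sum_distrib_left)
  also have "2 * (real d)\<^sup>2 * (\<Sum>c\<in>CL. real (x c)) = 2 * real d * total_queue x"
    unfolding sum_classes_total_queue[symmetric] by (simp add: power2_eq_square)
  also have "lam * real d * (2 * total_queue x + real n) + real d * busy x - 2 * real d * total_queue x
      \<le> lam * real d * (2 * total_queue x + real n) + real d * real n - 2 * real d * total_queue x"
    using busy_le[of x] by (simp add: mult_left_mono)
  also have "\<dots> = real d * real n * (1 + lam) - 2 * real d * (1 - lam) * total_queue x"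
    by (simp add: algebra_simps)
  finally show ?thesis .
qed

lemma sum_model_rates: "(\<Sum>c\<in>CL. arr * u + dep x c * v) = real n * lam * u + busy x * v"
  by (simp add: sum.distrib sum_dep flip: sum_distrib_right) (use sum_arr in simp)

text \<open>Up to the level \<open>N\<close> a departure lowers the truncated function by the full
  \<open>d\<close>. Above it the departure terms are merely nonpositive, and the amount lost is at
  most \<open>d * n\<close>.\<close>

lemma model_gen_min_total_queue_le:
  "model_gen (\<lambda>x. min (total_queue x) N) x \<le> real d * real n * lam - real d * busy x + real d * real n * of_bool (N < total_queue x)"
proof -
  have "model_gen (\<lambda>x. min (total_queue x) N) x
      \<le> (\<Sum>c\<in>CL. arr * real d + dep x c * (- real d * of_bool (\<not> N < total_queue x)))"
    unfolding model_gen_def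
  proof (intro sum_mono add_mono)
    fix c assume c: "c \<in> CL"
    show "arr * (min (total_queue (inc x c)) N - min (total_queue x) N) \<le> arr * real d"
      using arr_nonneg total_queue_inc[OF c, of x] by (intro mult_left_mono) auto
    show "dep x c * (min (total_queue (dec x c)) N - min (total_queue x) N) \<le> dep x c * (- real d * of_bool (\<not> N < total_queue x))"
    proof (cases "x c = 0")
      case False
      then show ?thesis
        using dep_nonneg total_queue_dec[OF c, of x] by (intro mult_left_mono) auto
    qed (simp add: dep_0)
  qed
  also have "\<dots> \<le> real d * real n * lam - real d * busy x + real d * real n * of_bool (N < total_queue x)"
    unfolding sum_model_rates using mult_left_mono[OF busy_le[of x], of "real d"] by (auto simp: mult_ac)
  finally show ?thesis .
qed

text \<open>The truncation level is raised by \<open>d\<close>, the size of an upward jump, so that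
  an arrival counts in full whenever the total queue is at most \<open>N\<close>.\<close>

lemma model_gen_min_total_queue_ge:
  "real d * real n * lam - real d * busy x - real d * real n * lam * of_bool (N < total_queue x)
     \<le> model_gen (\<lambda>x. min (total_queue x) (N + real d)) x"
proof -
  have "real d * real n * lam - real d * busy x - real d * real n * lam * of_bool (N < total_queue x)
    = (\<Sum>c\<in>CL. arr * (real d * of_bool (\<not> N < total_queue x)) + dep x c * (- real d))"
    unfolding sum_model_rates by (auto simp: mult_ac)
  also have "\<dots> \<le> model_gen (\<lambda>x. min (total_queue x) (N + real d)) x"
    unfolding model_gen_def
  proof (intro sum_mono add_mono)
    fix c assume c: "c \<in> CL"
    show "arr * (real d * of_bool (\<not> N < total_queue x)) \<le> arr * (min (total_queue (inc x c)) (N + real d) - min (total_queue x) (N + real d))"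
      using arr_nonneg total_queue_inc[OF c, of x] by (intro mult_left_mono) auto
    show "dep x c * (- real d) \<le> dep x c * (min (total_queue (dec x c)) (N + real d) - min (total_queue x) (N + real d))"
    proof (cases "x c = 0")
      case False
      then show ?thesis
        using dep_nonneg total_queue_dec[OF c, of x] by (intro mult_left_mono) auto
    qed (simp add: dep_0)
  qed
  finally show ?thesis .
qed

lemma service_rate_nonneg: "0 \<le> service_rate j x"
  unfolding service_rate_def by (intro sum_nonneg dep_nonneg)

lemma service_rate_le: "service_rate j x \<le> real d * real (q x j)"
proof -
  have "dep x c \<le> real d * real (x c)" if "c \<in> CL" for c
  proof -
    have "1 / real k \<le> 1" for k :: nat by (cases "k = 0") auto
    then have "(\<Sum>j\<in>c. 1 / real (q x j)) \<le> (\<Sum>j\<in>c. 1)"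
      by (intro sum_mono)
    then have "real (x c) * (\<Sum>j\<in>c. 1 / real (q x j)) \<le> real (x c) * real d"
      using card_class[OF that] by (intro mult_left_mono) auto
    then show ?thesis by (simp add: departure_rate_def mult.commute)
  qed
  then show ?thesis
    unfolding service_rate_def queue_real sum_distrib_left by (intro sum_mono) auto
qed

text \<open>Server \<open>j\<close> alone works at rate 1 when busy: in each class only the summand
  of \<open>j\<close> is kept.\<close>

lemma service_rate_ge:
  assumes "0 < q x j" shows "1 \<le> service_rate j x"
proof -
  have "1 = (\<Sum>c | c \<in> CL \<and> j \<in> c. real (x c) * (1 / real (q x j)))"
    unfolding sum_distrib_right[symmetric] queue_real[symmetric] using assms by simp
  also have "\<dots> \<le> service_rate j x"
    unfolding service_rate_def departure_rate_def
    by (intro sum_mono mult_left_mono member_le_sum) (auto intro: finite_class)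
  finally show ?thesis .
qed

text \<open>Equal sums of termwise ordered counts force each class count at \<open>j\<close> to
  agree, so only other queues can be longer in \<open>y\<close>, and the classwise comparison
  applies.\<close>

lemma service_rate_antimono:
  assumes "x \<le> y" "q x j = q y j" shows "service_rate j y \<le> service_rate j x"
  unfolding service_rate_def
proof (intro sum_mono dep_antimono assms)
  fix c assume c: "c \<in> {c \<in> CL. j \<in> c}"
  show "x c = y c"
    using sum_mono_inv[of x "{c \<in> CL. j \<in> c}" y c] assms c by (simp add: queue_def le_fun_def)
qed auto

text \<open>The indicator changes only when the queue moves between \<open>k\<close> and
  \<open>k + 1\<close>; the total arrival rate at the server is \<open>lam * d\<close>.\<close>

lemma model_gen_tail:
  assumes "j \<in> {1..n}"
  shows "model_gen (\<lambda>x. of_bool (k < q x j)) x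
     = lam * real d * of_bool (q x j = k) - service_rate j x * of_bool (q x j = k + 1)"
proof -
  have "model_gen (\<lambda>x. of_bool (k < q x j)) x
    = (\<Sum>c\<in>CL. if j \<in> c then arr * of_bool (q x j = k) - dep x c * of_bool (q x j = k + 1) else 0)"
    unfolding model_gen_def
  proof (rule sum.cong)
    fix c assume c: "c \<in> CL"
    have "arr * (of_bool (k < q (inc x c) j) - of_bool (k < q x j))
        = (if j \<in> c then arr * of_bool (q x j = k) else 0)"
      by (simp add: queue_inc[OF c])
    moreover have "dep x c * (of_bool (k < q (dec x c) j) - of_bool (k < q x j))
        = (if j \<in> c then - dep x c * of_bool (q x j = k + 1) else 0)"
    proof (cases "x c = 0")
      case False
      then show ?thesis using queue_dec[OF c, of x j] by (cases "j \<in> c") auto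
    qed (simp add: dep_0)
    ultimately show "arr * (of_bool (k < q (inc x c) j) - of_bool (k < q x j))
        + dep x c * (of_bool (k < q (dec x c) j) - of_bool (k < q x j))
      = (if j \<in> c then arr * of_bool (q x j = k) - dep x c * of_bool (q x j = k + 1) else 0)"
      by simp
  qed simp
  also have "\<dots> = (\<Sum>c | c \<in> CL \<and> j \<in> c. arr * of_bool (q x j = k) - dep x c * of_bool (q x j = k + 1))"
    by (rule sum.inter_filter[symmetric]) simp
  also have "\<dots> = real (card {c \<in> CL. j \<in> c}) * arr * of_bool (q x j = k) - service_rate j x * of_bool (q x j = k + 1)"
    by (simp add: sum_subtractf service_rate_def sum_distrib_right)
  finally show ?thesis using card_classes_containing[OF assms] by simp
qed

lemma expect_gen: "set_pmf p \<subseteq> ST \<Longrightarrow> expect p (gen f) = expect p (model_gen f)"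
  by (rule integral_cong_AE) (auto simp: AE_measure_pmf_iff gen_eq subset_iff)

lemma model_gen_bounded:
  assumes "\<And>y. \<bar>f y\<bar> \<le> B" and "x \<in> ST"
  shows "\<bar>model_gen f x\<bar> \<le> 2 * B * rate_bound"
  using gen_bounded[of f B x] assms gen_eq[of x f] by simp

lemma tail_mono: "mono_on ST (\<lambda>x. of_bool (k < q x j) :: real)"
  by (rule mono_onI) (use queue_mono[of _ _ j] in \<open>auto intro: less_le_trans\<close>)

lemma busy_mono: "mono_on ST busy"
  unfolding busy_def by (rule mono_onI, rule sum_mono) (use queue_mono in \<open>auto intro: less_le_trans\<close>)

end

section \<open>Comparison with a stationary distribution\<close>

locale stationary_parallel_servers = parallel_servers +
  fixes \<pi> :: "state pmf"
  assumes st: "stationary_distribution (states n d) P \<pi>"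
begin

lemma set_\<pi>: "set_pmf \<pi> \<subseteq> ST"
  using st by (simp add: stationary_distribution_def)

lemma expect_empty_le_\<pi>:
  assumes "0 \<le> t" "mono_on ST f" "\<And>y. \<bar>f y\<bar> \<le> B"
  shows "expect (P t empty_state) f \<le> expect \<pi> f"
  using expect_P_empty_le[OF assms set_\<pi>] stationary_expect_P[OF st assms(1,3)] by simp

section \<open>Stationary moment bounds from truncated drifts\<close>

lemma \<pi>_model_gen: "(\<And>y. \<bar>f y\<bar> \<le> B) \<Longrightarrow> expect \<pi> (model_gen f) = 0"
  using stationary_gen[OF st, of f B] expect_gen[OF set_\<pi>, of f] by simp



text \<open>The truncated sum of squares is bounded, so its stationary drift vanishes. The cut-off
  in the conclusion is by the squares because on that set the drift bound survives truncation, and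
  because there the total queue is at most \<open>N\<close>.\<close>

lemma \<pi>_total_queue_truncated:
  "expect \<pi> (\<lambda>x. of_bool (sum_squares x \<le> real N) * total_queue x) \<le> real n * mean_queue_bound lam"
proof -
  let ?K1 = "real d * real n * (1 + lam)" and ?K2 = "2 * real d * (1 - lam)"
  have V0: "0 \<le> sum_squares x" for x by (simp add: sum_squares_def sum_nonneg)

  have K2: "0 < ?K2" using lam_less_1 d_pos by simp
  let ?f = "\<lambda>x. min (sum_squares x) (real N)"
  have f: "\<bar>?f y\<bar> \<le> real N" for y using V0[of y] by simp
  let ?g = "\<lambda>x. of_bool (sum_squares x \<le> real N) * total_queue x"
  have g: "\<bar>?g y\<bar> \<le> real N" for y using total_queue_le_sum_squares[of y] total_queue_nonneg[of y] by auto
  have le: "model_gen ?f x \<le> ?K1 - ?K2 * ?g x" for x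
  proof (cases "sum_squares x \<le> real N")
    case True
    have "model_gen ?f x \<le> model_gen sum_squares x"
      unfolding model_gen_def using True arr_nonneg dep_nonneg
      by (intro sum_mono add_mono mult_left_mono) auto
    then show ?thesis using model_gen_sum_squares_le[of x] True by simp
  next
    case False
    \<comment> \<open>At the truncation level the function cannot increase, while the right-hand
      side reduces to the nonnegative constant \<open>?K1\<close>.\<close>
    have "model_gen ?f x \<le> 0"
      unfolding model_gen_def using False arr_nonneg dep_nonneg
      by (intro sum_nonpos add_nonpos_nonpos mult_nonneg_nonpos) auto
    moreover have "0 \<le> ?K1" using lam_pos by simp
    ultimately show ?thesis using False by simp
  qed
  have "0 = expect \<pi> (model_gen ?f)"
    using \<pi>_model_gen[OF f] by simp
  also have "\<dots> \<le> expect \<pi> (\<lambda>x. ?K1 - ?K2 * ?g x)"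
  proof (intro integral_mono_AE)
    show "integrable (measure_pmf \<pi>) (model_gen ?f)"
      by (rule integrable_pmf_bounded[where B="2 * real N * rate_bound"], rule model_gen_bounded[OF f])
         (use set_\<pi> in auto)
    show "integrable (measure_pmf \<pi>) (\<lambda>x. ?K1 - ?K2 * ?g x)"
      by (intro Bochner_Integration.integrable_diff measure_pmf.integrable_const integrable_mult_right
          integrable_pmf_bounded[OF g])
  qed (use le in auto)
  also have "\<dots> = ?K1 - ?K2 * expect \<pi> ?g"
    using g by (simp add: integrable_pmf_bounded[where B="real N"])
  finally have "expect \<pi> ?g * ?K2 \<le> ?K1"
    by (subst mult.commute) linarith
  then have "expect \<pi> ?g \<le> ?K1 / ?K2"
    by (subst pos_le_divide_eq[OF K2])
  also have "?K1 / ?K2 = real n * mean_queue_bound lam"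
    using d_pos by (simp add: mean_queue_bound_def)
  finally show ?thesis .
qed

text \<open>Stated for bounded minorants of the total queue, so that integrability of the latter
  never enters: outside the truncation set \<open>f\<close> contributes at most \<open>B\<close>
  times a vanishing probability.\<close>

lemma \<pi>_le_mean:
  assumes f: "\<And>x. 0 \<le> f x" "\<And>x. f x \<le> total_queue x" "\<And>x. f x \<le> B"
  shows "expect \<pi> f \<le> real n * mean_queue_bound lam"
proof (rule LIMSEQ_le_const)
  have fb: "\<bar>f x\<bar> \<le> B" for x using f[of x] by simp
  have B: "0 \<le> B" using f[of "\<lambda>_. 0"] by linarith
  show "(\<lambda>N. real n * mean_queue_bound lam + B * expect \<pi> (\<lambda>x. of_bool (real N < sum_squares x))) \<longlonglongrightarrow> real n * mean_queue_bound lam"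
    by (rule tendsto_eq_intros prob_tail_tendsto_0 refl | simp)+
  have "expect \<pi> f \<le> real n * mean_queue_bound lam + B * expect \<pi> (\<lambda>x. of_bool (real N < sum_squares x))" for N
  proof -
    let ?g = "\<lambda>x. of_bool (sum_squares x \<le> real N) * f x"
    have "expect \<pi> f = expect \<pi> (\<lambda>x. ?g x + of_bool (real N < sum_squares x) * f x)"
      by (rule Bochner_Integration.integral_cong) auto
    also have "\<dots> \<le> expect \<pi> (\<lambda>x. ?g x + B * of_bool (real N < sum_squares x))"
    proof (rule expect_mono[where B=B and C="B + B"])
      fix y
      show "\<bar>?g y + B * of_bool (real N < sum_squares y)\<bar> \<le> B + B"
        using fb[of y] B by (cases "real N < sum_squares y") auto
    qed (use fb f(3) in auto)
    also have "\<dots> = expect \<pi> ?g + B * expect \<pi> (\<lambda>x. of_bool (real N < sum_squares x))"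
    proof -
      have "integrable (measure_pmf \<pi>) ?g"
        by (rule integrable_pmf_bounded[where B=B]) (use fb B in auto)
      moreover have "integrable (measure_pmf \<pi>) (\<lambda>x. of_bool (real N < sum_squares x) :: real)"
        by (rule integrable_pmf_bounded[where B=1]) auto
      ultimately show ?thesis by simp
    qed
    also have "expect \<pi> ?g \<le> expect \<pi> (\<lambda>x. of_bool (sum_squares x \<le> real N) * total_queue x)"
    proof (rule expect_mono[where B=B and C="real N"])
      fix y
      show "\<bar>of_bool (sum_squares y \<le> real N) * total_queue y\<bar> \<le> real N"
        using total_queue_le_sum_squares[of y] total_queue_nonneg[of y] by auto
    qed (use f fb B in auto)
    also note \<pi>_total_queue_truncated
    finally show ?thesis by simp
  qed
  then show "\<exists>N. \<forall>k\<ge>N. expect \<pi> f \<le> real n * mean_queue_bound lam + B * expect \<pi> (\<lambda>x. of_bool (real k < sum_squares x))"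
    by blast
qed

section \<open>The busy-server deficit\<close>

lemma abs_busy_le: "\<bar>busy y\<bar> \<le> real n"
  using busy_nonneg[of y] busy_le[of y] by simp

text \<open>The truncated total queue has zero stationary drift, so mean departures cannot exceed
  mean arrivals up to a truncation error that vanishes with growing \<open>N\<close>.\<close>

lemma \<pi>_busy_le: "expect \<pi> busy \<le> real n * lam"
proof (rule LIMSEQ_le_const)
  show "(\<lambda>N. real n * lam + real n * expect \<pi> (\<lambda>x. of_bool (real N < total_queue x))) \<longlonglongrightarrow> real n * lam"
    by (rule tendsto_eq_intros prob_tail_tendsto_0 refl | simp)+
  have "expect \<pi> busy \<le> real n * lam + real n * expect \<pi> (\<lambda>x. of_bool (real N < total_queue x))" for N
  proof -
    let ?f = "\<lambda>x. min (total_queue x) (real N)"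
    have f: "\<bar>?f y\<bar> \<le> real N" for y using total_queue_nonneg[of y] by simp
    have int: "integrable (measure_pmf \<pi>) busy" "integrable (measure_pmf \<pi>) (\<lambda>x. of_bool (real N < total_queue x) :: real)"
      by (rule integrable_pmf_bounded[OF abs_busy_le], rule integrable_pmf_bounded[where B=1]) auto
    have "0 = expect \<pi> (model_gen ?f)"
      using \<pi>_model_gen[OF f] by simp
    also have "\<dots> \<le> expect \<pi> (\<lambda>x. real d * real n * lam - real d * busy x + real d * real n * of_bool (real N < total_queue x))"
    proof (intro integral_mono_AE)
      show "integrable (measure_pmf \<pi>) (model_gen ?f)"
        by (rule integrable_pmf_bounded[where B="2 * real N * rate_bound"], rule model_gen_bounded[OF f])
           (use set_\<pi> in auto)
    qed (use model_gen_min_total_queue_le int in auto)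
    also have "\<dots> = real d * (real n * lam - expect \<pi> busy + real n * expect \<pi> (\<lambda>x. of_bool (real N < total_queue x)))"
      using int by (simp add: algebra_simps)
    finally show ?thesis using d_pos by (simp add: zero_le_mult_iff)
  qed
  then show "\<exists>N. \<forall>k\<ge>N. expect \<pi> busy \<le> real n * lam + real n * expect \<pi> (\<lambda>x. of_bool (real k < total_queue x))"
    by blast
qed

lemma busy_deficit:
  assumes T: "0 < T"
  shows "real n * lam - expect (P T empty_state) busy \<le> real n * mean_queue_bound lam / (T * real d)"
proof -
  have "T * real d * (real n * lam - expect (P T empty_state) busy) \<le> real n * mean_queue_bound lam"
  proof (rule LIMSEQ_le_const)
    show "(\<lambda>N. real n * mean_queue_bound lam + T * real d * real n * lam * expect \<pi> (\<lambda>x. of_bool (real N < total_queue x)))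
        \<longlonglongrightarrow> real n * mean_queue_bound lam"
      by (rule tendsto_eq_intros prob_tail_tendsto_0 refl | simp)+
    have "T * real d * (real n * lam - expect (P T empty_state) busy)
      \<le> real n * mean_queue_bound lam + T * real d * real n * lam * expect \<pi> (\<lambda>x. of_bool (real N < total_queue x))" for N
    proof -
      let ?f = "\<lambda>x. min (total_queue x) (real N + real d)" and ?o = "\<lambda>x. of_bool (real N < total_queue x) :: real"
      have f: "\<bar>?f y\<bar> \<le> real N + real d" for y using total_queue_nonneg[of y] by simp
      have fm: "mono_on ST ?f" by (rule mono_onI, rule min.mono) (auto intro: total_queue_mono)
      have om: "mono_on ST ?o" by (rule mono_onI) (use total_queue_mono in \<open>auto intro: less_le_trans\<close>)
      \<comment> \<open>This \<open>z\<close> depends on the truncation level. The busy servers at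
        \<open>z\<close> are compared with those at \<open>T\<close>, and the overflow probability
        at \<open>z\<close> with the stationary one, so that the final bound is free of
        \<open>z\<close> before \<open>N\<close> tends to infinity.\<close>
      obtain z where z: "0 < z" "z < T" "expect (P T empty_state) ?f - ?f empty_state = T * expect (P z empty_state) (gen ?f)"
        by (rule expect_P_mvt[OF T empty_state f])
      have sz: "set_pmf (P z empty_state) \<subseteq> ST" using set_P z by auto
      have int: "integrable (measure_pmf p) busy" "integrable (measure_pmf p) ?o" for p
        by (rule integrable_pmf_bounded[OF abs_busy_le], rule integrable_pmf_bounded[where B=1]) auto
      have "expect (P z empty_state) busy \<le> expect (P (z + (T - z)) empty_state) busy"
        by (rule expect_empty_mono_time[OF _ _ busy_mono abs_busy_le]) (use z in auto)
      then have b: "expect (P z empty_state) busy \<le> expect (P T empty_state) busy" by simp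
      have o: "expect (P z empty_state) ?o \<le> expect \<pi> ?o"
        by (rule expect_empty_le_\<pi>[where B=1, OF _ om]) (use z in auto)
      have "real d * (real n * lam - expect (P T empty_state) busy) - real d * real n * lam * expect \<pi> ?o
        \<le> real d * real n * lam - real d * expect (P z empty_state) busy - real d * real n * lam * expect (P z empty_state) ?o"
      proof -
        have "real d * expect (P z empty_state) busy \<le> real d * expect (P T empty_state) busy"
          using b by (rule mult_left_mono) simp
        moreover have "real d * real n * lam * expect (P z empty_state) ?o \<le> real d * real n * lam * expect \<pi> ?o"
          using o by (rule mult_left_mono) (use lam_pos in simp)
        ultimately show ?thesis by (simp add: algebra_simps)
      qed
      also have "\<dots> = expect (P z empty_state) (\<lambda>x. real d * real n * lam - real d * busy x - real d * real n * lam * ?o x)"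
        using int by simp
      also have "\<dots> \<le> expect (P z empty_state) (model_gen ?f)"
      proof (intro integral_mono_AE)
        show "integrable (measure_pmf (P z empty_state)) (model_gen ?f)"
          by (rule integrable_pmf_bounded[where B="2 * (real N + real d) * rate_bound"], rule model_gen_bounded[OF f])
             (use sz in auto)
      qed (use model_gen_min_total_queue_ge int in auto)
      also have "\<dots> = expect (P z empty_state) (gen ?f)"
        using expect_gen[OF sz] by simp
      finally have "T * (real d * (real n * lam - expect (P T empty_state) busy) - real d * real n * lam * expect \<pi> ?o)
        \<le> T * expect (P z empty_state) (gen ?f)"
        using T by (intro mult_left_mono) auto
      also have "\<dots> = expect (P T empty_state) ?f" using z(3) by simp
      also have "\<dots> \<le> expect \<pi> ?f"
        by (rule expect_empty_le_\<pi>[OF _ fm f]) (use T in simp)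
      also have "\<dots> \<le> real n * mean_queue_bound lam"
        by (rule \<pi>_le_mean[where B="real N + real d"]) (use total_queue_nonneg in auto)
      finally show ?thesis by (simp add: algebra_simps)
    qed
    then show "\<exists>N. \<forall>k\<ge>N. T * real d * (real n * lam - expect (P T empty_state) busy)
      \<le> real n * mean_queue_bound lam + T * real d * real n * lam * expect \<pi> (\<lambda>x. of_bool (real k < total_queue x))"
      by blast
  qed
  then show ?thesis using T d_pos by (simp add: field_simps)
qed

section \<open>Tail gaps and their recursion\<close>

definition gap :: "real \<Rightarrow> nat \<Rightarrow> nat \<Rightarrow> real" where
  "gap t k j = expect \<pi> (\<lambda>x. of_bool (k < q x j)) - expect (P t empty_state) (\<lambda>x. of_bool (k < q x j))"

lemma gap_nonneg: "0 \<le> t \<Longrightarrow> 0 \<le> gap t k j"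
  using expect_empty_le_\<pi>[of t "\<lambda>x. of_bool (k < q x j)" 1] tail_mono by (simp add: gap_def)

lemma expect_sum_tail:
  "expect p (\<lambda>x. \<Sum>j=1..n. of_bool (k < q x j)) = (\<Sum>j=1..n. expect p (\<lambda>x. of_bool (k < q x j)))"
  by (rule Bochner_Integration.integral_sum) (auto intro!: integrable_pmf_bounded[where B=1])

lemma sum_gap_0:
  assumes "0 < t" shows "(\<Sum>j=1..n. gap t 0 j) \<le> real n * mean_queue_bound lam / (t * real d)"
proof -
  have "(\<Sum>j=1..n. gap t 0 j) = expect \<pi> busy - expect (P t empty_state) busy"
    unfolding gap_def busy_def expect_sum_tail by (simp add: sum_subtractf)
  also have "\<dots> \<le> real n * mean_queue_bound lam / (t * real d)"
    using \<pi>_busy_le busy_deficit[OF assms] by simp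
  finally show ?thesis .
qed

lemma gap_Suc:
  assumes t: "0 \<le> t" and j: "j \<in> {1..n}"
  shows "gap t (Suc k) j \<le> real d * (real (Suc k) + lam) * gap t k j"
proof -
  let ?D = "real d * real (Suc k)"
  let ?s = "\<lambda>x. service_rate j x * of_bool (q x j = k + 1)"
  let ?t = "\<lambda>k x. of_bool (k < q x j) :: real"
  let ?e = "\<lambda>x. of_bool (q x j = k) :: real"
  let ?F = "\<lambda>x. ?D * ?t k x - ?s x - ?t (Suc k) x"
  have D1: "1 \<le> ?D"
    using d_pos mult_mono[of 1 "real d" 1 "real (Suc k)"] by simp
  have s: "0 \<le> ?s x" "?s x \<le> ?D" "\<bar>?s x\<bar> \<le> ?D" for x
    using service_rate_nonneg[of j x] service_rate_le[of j x] by auto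
  have int: "integrable (measure_pmf p) ?s" "integrable (measure_pmf p) (?t k)"
     "integrable (measure_pmf p) (?t (Suc k))" "integrable (measure_pmf p) ?e" for p
    by (rule integrable_pmf_bounded[OF s(3)], (rule integrable_pmf_bounded[where B=1]; simp)+)
  have Fm: "mono_on ST ?F"
  proof (rule mono_onI)
    fix x y assume "x \<in> ST" "y \<in> ST" and xy: "x \<le> y"
    have qq: "q x j \<le> q y j" by (rule queue_mono[OF xy])
    \<comment> \<open>With both queues at \<open>k + 1\<close> the service rate has to be antitone.
      If only \<open>y\<close> is longer, the loss of the last indicator is paid for by a service
      rate of at least 1 in \<open>x\<close>. If the queue in \<open>x\<close> is at most
      \<open>k\<close>, then \<open>?D\<close> dominates whatever is subtracted in
      \<open>y\<close>.\<close>
    consider "q x j \<le> k" | "q x j = k + 1" "q y j = k + 1" | "q x j = k + 1" "k + 1 < q y j" | "k + 1 < q x j"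
      using qq by linarith
    then show "?F x \<le> ?F y"
    proof cases
      case 1
      then show ?thesis using s(2)[of y] D1 by auto
    next
      case 2
      then show ?thesis using service_rate_antimono[OF xy, of j] by simp
    next
      case 3
      then show ?thesis using service_rate_ge[of x j] by simp
    next
      case 4
      then show ?thesis using qq by simp
    qed
  qed
  have Fb: "\<bar>?F x\<bar> \<le> 3 * ?D" for x
    using s(1,2)[of x] D1 by (cases "k < q x j"; cases "Suc k < q x j") auto
  have EF: "expect p ?F = ?D * expect p (?t k) - expect p ?s - expect p (?t (Suc k))" for p
    using int[of p] by simp
  have gen: "expect p (model_gen (?t k)) = lam * real d * expect p ?e - expect p ?s" for p
    using int[of p] unfolding model_gen_tail[OF j] by simp
  \<comment> \<open>Tails of the chain started empty grow in time, so their drift is nonnegative,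
    while under \<pi> it is 0. This turns expected service rates into probabilities of a queue of
    length exactly \<open>k\<close>.\<close>
  have "0 \<le> expect (P t empty_state) (gen (?t k))"
    by (rule expect_P_gen_nonneg[where B=1, OF t empty_state _ expect_empty_mono_time[where B=1]])
       (use t tail_mono in auto)
  then have 1: "expect (P t empty_state) ?s \<le> lam * real d * expect (P t empty_state) ?e"
    using expect_gen[OF set_P[OF t empty_state]] gen by simp
  have 2: "expect \<pi> ?s = lam * real d * expect \<pi> ?e"
    using \<pi>_model_gen[of "?t k" 1] gen by simp
  \<comment> \<open>A single level is the difference of two tails. Only the tail above
    \<open>k\<close> enters with the wrong sign, at the cost of one \<open>gap t k j\<close>;
    writing the other tail as \<open>k \<le> q x j\<close> covers \<open>k = 0\<close>.\<close>
  have 3: "- gap t k j \<le> expect \<pi> ?e - expect (P t empty_state) ?e"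
  proof -
    let ?u = "\<lambda>x. of_bool (k \<le> q x j) :: real"
    have iu: "integrable (measure_pmf p) ?u" for p
      by (auto intro!: integrable_pmf_bounded[where B=1])
    have "expect p ?e = expect p ?u - expect p (?t k)" for p
      unfolding Bochner_Integration.integral_diff[OF iu int(2), symmetric]
      by (rule Bochner_Integration.integral_cong) auto
    moreover have "expect (P t empty_state) ?u \<le> expect \<pi> ?u"
      by (rule expect_empty_le_\<pi>[where B=1, OF t], rule mono_onI)
         (use queue_mono[of _ _ j] in \<open>auto intro: le_trans\<close>)
    ultimately show ?thesis by (simp add: gap_def)
  qed
  have "lam * real d * (- gap t k j) \<le> lam * real d * (expect \<pi> ?e - expect (P t empty_state) ?e)"
    using 3 lam_pos by (intro mult_left_mono) auto
  also have "\<dots> \<le> expect \<pi> ?s - expect (P t empty_state) ?s"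
    using 1 2 by (simp add: algebra_simps)
  finally have "- lam * real d * gap t k j \<le> expect \<pi> ?s - expect (P t empty_state) ?s" by simp
  moreover have "expect (P t empty_state) ?F \<le> expect \<pi> ?F"
    by (rule expect_empty_le_\<pi>[OF t Fm Fb])
  ultimately show ?thesis
    unfolding EF gap_def by (simp add: algebra_simps)
qed



lemma tail_factor_nonneg: "0 \<le> tail_factor d lam k"
  unfolding tail_factor_def using lam_pos by (intro prod_nonneg) auto

lemma gap_le_gap_0:
  assumes "0 \<le> t" and "j \<in> {1..n}"
  shows "gap t k j \<le> tail_factor d lam k * gap t 0 j"
proof (induction k)
  case (Suc k)
  have "gap t (Suc k) j \<le> real d * (real (Suc k) + lam) * gap t k j"
    by (rule gap_Suc[OF assms])
  also have "\<dots> \<le> real d * (real (Suc k) + lam) * (tail_factor d lam k * gap t 0 j)"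
    using Suc lam_pos by (intro mult_left_mono) auto
  finally show ?case by (simp add: tail_factor_def mult_ac)
qed (simp add: tail_factor_def)

text \<open>
  Invariance of \<open>\<pi>\<close> itself under relabelling would need uniqueness of the stationary distribution;
  the single-queue tails are limits of those of the chain started empty.
\<close>

lemma \<pi>_exchangeable:
  assumes i: "i \<in> {1..n}" and j: "j \<in> {1..n}"
  shows "expect \<pi> (\<lambda>x. of_bool (k < q x i)) = expect \<pi> (\<lambda>x. of_bool (k < q x j))"
proof -
  \<comment> \<open>The dependence on \<open>n\<close> is harmless here: only a limit in
    \<open>t\<close> for fixed \<open>n\<close> is taken.\<close>
  define K where "K = tail_factor d lam k * (real n * mean_queue_bound lam / real d)"
  have gap: "gap t k l \<le> K / t" if t: "0 < t" and l: "l \<in> {1..n}" for t l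
  proof -
    have "gap t 0 l \<le> (\<Sum>j=1..n. gap t 0 j)"
      using gap_nonneg t l by (intro member_le_sum) auto
    also note sum_gap_0[OF t]
    finally have "tail_factor d lam k * gap t 0 l \<le> tail_factor d lam k * (real n * mean_queue_bound lam / (t * real d))"
      using tail_factor_nonneg by (rule mult_left_mono)
    then show ?thesis
      using gap_le_gap_0[of t l k] t l by (simp add: K_def mult.commute)
  qed
  have "(\<lambda>m. expect (P (real (Suc m)) empty_state) (\<lambda>x. of_bool (k < q x l)))
      \<longlonglongrightarrow> expect \<pi> (\<lambda>x. of_bool (k < q x l))" if l: "l \<in> {1..n}" for l
  proof -
    have "(\<lambda>m. gap (real (Suc m)) k l) \<longlonglongrightarrow> 0"
    proof (rule tendsto_sandwich[OF _ _ tendsto_const])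
      show "(\<lambda>m. K * (1 / real (Suc m))) \<longlonglongrightarrow> 0"
        using tendsto_mult[OF tendsto_const[of K] LIMSEQ_inverse_real_of_nat] by (simp add: inverse_eq_divide)
      show "\<forall>\<^sub>F m in sequentially. 0 \<le> gap (real (Suc m)) k l"
        using gap_nonneg by simp
      show "\<forall>\<^sub>F m in sequentially. gap (real (Suc m)) k l \<le> K * (1 / real (Suc m))"
        using gap[OF _ l, of "real (Suc _)"] by simp
    qed
    from tendsto_diff[OF tendsto_const[of "expect \<pi> (\<lambda>x. of_bool (k < q x l))"] this]
    show ?thesis by (simp add: gap_def)
  qed
  note lim = this
  have eq: "expect (P (real (Suc m)) empty_state) (\<lambda>x. of_bool (k < q x i))
      = expect (P (real (Suc m)) empty_state) (\<lambda>x. of_bool (k < q x j))" for m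
    by (rule expect_empty_exchangeable[OF _ i j, of _ "\<lambda>a. of_bool (k < a)" 1]) auto
  show ?thesis
    by (rule LIMSEQ_unique[OF lim[OF i, unfolded eq] lim[OF j]])
qed

section \<open>Estimates for one server, uniform in the number of servers\<close>

lemma one_server: "1 \<in> {1..n}"
  using n_pos by simp

text \<open>All \<open>n\<close> gaps at level 0 are equal, so their sum is \<open>n\<close> times
  one of them and the factor \<open>n\<close> in the bound cancels.\<close>

lemma gap_1_le:
  assumes t: "0 < t"
  shows "gap t k 1 \<le> tail_factor d lam k * (mean_queue_bound lam / (t * real d))"
proof -
  have eq: "gap t 0 j = gap t 0 1" if "j \<in> {1..n}" for j
    using \<pi>_exchangeable[OF that one_server, of 0] expect_empty_exchangeable[OF _ that one_server, of t "\<lambda>a. of_bool (0 < a)" 1] t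
    by (simp add: gap_def)
  have "real n * gap t 0 1 = (\<Sum>j=1..n. gap t 0 1)" by simp
  also have "\<dots> = (\<Sum>j=1..n. gap t 0 j)"
    by (rule sum.cong[OF refl]) (simp only: eq)
  also note sum_gap_0[OF t]
  finally have "gap t 0 1 \<le> mean_queue_bound lam / (t * real d)"
    using n_pos by (simp add: mult_le_cancel_left_pos flip: times_divide_eq_right)
  then have "tail_factor d lam k * gap t 0 1 \<le> tail_factor d lam k * (mean_queue_bound lam / (t * real d))"
    using tail_factor_nonneg by (rule mult_left_mono)
  then show ?thesis
    using gap_le_gap_0[of t 1 k] t one_server by simp
qed

text \<open>Markov's inequality averaged over the servers: each queue longer than \<open>K\<close>
  contributes at least \<open>K + 1\<close> to the total queue, whose mean is what has been bounded.
  Exchangeability returns to one server.\<close>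

lemma \<pi>_tail_le: "expect \<pi> (\<lambda>x. of_bool (K < q x 1)) \<le> mean_queue_bound lam / real (Suc K)"
proof -
  let ?f = "\<lambda>x. real (Suc K) * (\<Sum>j=1..n. of_bool (K < q x j))"
  have le: "?f x \<le> total_queue x" for x
    unfolding total_queue_def sum_distrib_left by (rule sum_mono) auto
  have s: "(\<Sum>j=1..n. of_bool (K < q x j)) \<le> (\<Sum>j=1..n. 1 :: real)" for x
    by (rule sum_mono) auto
  have "expect \<pi> ?f \<le> real n * mean_queue_bound lam"
    by (rule \<pi>_le_mean[where B="real (Suc K) * (\<Sum>j=1..n. 1)", OF _ le mult_left_mono[OF s]])
       (auto intro!: mult_nonneg_nonneg sum_nonneg)
  moreover have "expect \<pi> ?f = real (Suc K) * (\<Sum>j=1..n. expect \<pi> (\<lambda>x. of_bool (K < q x j)))"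
    unfolding expect_sum_tail[symmetric] by (rule integral_mult_right_zero)
  moreover have "(\<Sum>j=1..n. expect \<pi> (\<lambda>x. of_bool (K < q x j))) = (\<Sum>j=1..n. expect \<pi> (\<lambda>x. of_bool (K < q x 1)))"
    by (rule sum.cong[OF refl], rule \<pi>_exchangeable[OF _ one_server]) simp
  ultimately have "real n * (real (Suc K) * expect \<pi> (\<lambda>x. of_bool (K < q x 1))) \<le> real n * mean_queue_bound lam"
    by (simp add: mult_ac)
  then have "real (Suc K) * expect \<pi> (\<lambda>x. of_bool (K < q x 1)) \<le> mean_queue_bound lam"
    using n_pos by (subst (asm) mult_le_cancel_left_pos) auto
  then show ?thesis by (simp add: field_simps)
qed

text \<open>Summation by parts writes a function of the truncated queue in terms of tail indicators.\<close>

lemma expect_diff_le: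
  fixes g :: "nat \<Rightarrow> real"
  assumes t: "0 < t" and g: "\<And>k. 0 \<le> g k" "\<And>k. g k \<le> 1"
  shows "\<bar>expect (P t empty_state) (\<lambda>x. g (q x 1)) - expect \<pi> (\<lambda>x. g (q x 1))\<bar>
     \<le> (\<Sum>k<K. tail_factor d lam k) * (mean_queue_bound lam / (t * real d)) + 2 * (mean_queue_bound lam / real (Suc K))"
proof -
  let ?t = "\<lambda>k x. of_bool (k < q x 1) :: real"
  let ?r = "\<lambda>x. (g (q x 1) - g K) * ?t K x"
  have g1: "\<bar>g a - g b\<bar> \<le> 1" for a b using g[of a] g[of b] by linarith
  have decomp: "g m = g 0 + (\<Sum>k<K. (g (Suc k) - g k) * of_bool (k < m)) + (g m - g K) * of_bool (K < m)" for m
  proof (induction K)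
    case (Suc K)
    then show ?case by (cases "K < m"; cases "m = Suc K") auto
  qed simp
  have it: "integrable (measure_pmf p) (?t k)" for p k
    by (auto intro!: integrable_pmf_bounded[where B=1])
  have rb: "\<bar>?r x\<bar> \<le> ?t K x" for x using g1 by auto
  have ir: "integrable (measure_pmf p) ?r" for p
    by (rule integrable_pmf_bounded[where B=1]) (use g1 in auto)
  let ?S = "\<lambda>x. \<Sum>k<K. (g (Suc k) - g k) * ?t k x"
  have iS: "integrable (measure_pmf p) ?S" for p
    by (intro Bochner_Integration.integrable_sum integrable_mult_right it)
  have S: "expect p ?S = (\<Sum>k<K. (g (Suc k) - g k) * expect p (?t k))" for p
    using it by (simp only: Bochner_Integration.integral_sum integrable_mult_right integral_mult_right_zero)
  have E: "expect p (\<lambda>x. g (q x 1)) = g 0 + (\<Sum>k<K. (g (Suc k) - g k) * expect p (?t k)) + expect p ?r" for p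
  proof -
    have "expect p (\<lambda>x. g (q x 1)) = expect p (\<lambda>x. g 0 + (\<Sum>k<K. (g (Suc k) - g k) * ?t k x) + ?r x)"
      by (rule Bochner_Integration.integral_cong[OF refl]) (rule decomp)
    also have "\<dots> = g 0 + (\<Sum>k<K. (g (Suc k) - g k) * expect p (?t k)) + expect p ?r"
      by (simp only: Bochner_Integration.integral_add Bochner_Integration.integrable_add
          measure_pmf.integrable_const iS ir S) simp
    finally show ?thesis .
  qed
  have Er: "\<bar>expect p ?r\<bar> \<le> expect p (?t K)" for p
  proof -
    have "\<bar>expect p ?r\<bar> \<le> expect p (\<lambda>x. \<bar>?r x\<bar>)" by (rule integral_abs_bound)
    also have "\<dots> \<le> expect p (?t K)"
      by (rule expect_mono[where B=1 and C=1]) (use rb g1 in auto)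
    finally show ?thesis .
  qed
  \<comment> \<open>Both remainders are bounded by tails at \<open>K\<close>, and the transient tail
    lies below the stationary one; hence the factor 2.\<close>
  have "expect (P t empty_state) (?t K) \<le> expect \<pi> (?t K)"
    using gap_nonneg[of t K 1] t by (simp add: gap_def)
  then have r: "\<bar>expect (P t empty_state) ?r - expect \<pi> ?r\<bar> \<le> 2 * (mean_queue_bound lam / real (Suc K))"
    using Er[of "P t empty_state"] Er[of \<pi>] \<pi>_tail_le[of K] by linarith
  have "\<bar>\<Sum>k<K. (g (Suc k) - g k) * (- gap t k 1)\<bar> \<le> (\<Sum>k<K. tail_factor d lam k * (mean_queue_bound lam / (t * real d)))"
  proof (rule order_trans[OF sum_abs], rule sum_mono)
    fix k
    have "\<bar>(g (Suc k) - g k) * (- gap t k 1)\<bar> \<le> 1 * gap t k 1"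
      unfolding abs_mult abs_minus_cancel using gap_nonneg[of t k 1] t g1 by (intro mult_mono) auto
    then show "\<bar>(g (Suc k) - g k) * (- gap t k 1)\<bar> \<le> tail_factor d lam k * (mean_queue_bound lam / (t * real d))"
      using gap_1_le[OF t, of k] by simp
  qed
  moreover have "expect (P t empty_state) (\<lambda>x. g (q x 1)) - expect \<pi> (\<lambda>x. g (q x 1))
     = (\<Sum>k<K. (g (Suc k) - g k) * (- gap t k 1)) + (expect (P t empty_state) ?r - expect \<pi> ?r)"
  proof -
    have "(\<Sum>k<K. (g (Suc k) - g k) * (- gap t k 1))
      = (\<Sum>k<K. (g (Suc k) - g k) * expect (P t empty_state) (?t k)) - (\<Sum>k<K. (g (Suc k) - g k) * expect \<pi> (?t k))"
      unfolding gap_def sum_subtractf[symmetric] by (rule sum.cong) (simp_all add: algebra_simps)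
    then show ?thesis unfolding E by simp
  qed
  ultimately show ?thesis using r unfolding sum_distrib_right by linarith
qed

end

section \<open>Laws of the process at fixed times\<close>

lemma markov_process_measurable:
  assumes "markov_process S P M X" and "0 \<le> t"
  shows "X t \<in> measurable M (count_space UNIV)"
proof -
  have "X t \<in> measurable M (count_space S)"
    using assms by (simp add: markov_process_def)
  from measurable_compose[OF this, of "\<lambda>x. x" "count_space UNIV"] show ?thesis by simp
qed

text \<open>The joint law at times 0 and \<open>t\<close> gives the probabilities of single states.
  These determine the law of \<open>X t\<close>, because the support of a pmf is countable and
  already carries mass 1.\<close>

lemma markov_process_law:
  assumes mp: "markov_process S P M X" and x: "x \<in> S" and start: "AE \<omega> in M. X 0 \<omega> = x"
    and P: "set_pmf (P t x) \<subseteq> S" and t: "0 < t"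
  shows "distr M (count_space UNIV) (X t) = measure_pmf (P t x)"
proof -
  interpret prob_space M using mp by (simp add: markov_process_def)
  have [measurable]: "X t \<in> measurable M (count_space UNIV)" "X 0 \<in> measurable M (count_space UNIV)"
    using markov_process_measurable[OF mp] t by auto
  interpret D: prob_space "distr M (count_space UNIV) (X t)"
    by (rule prob_space_distr) measurable
  have start1: "prob {\<omega> \<in> space M. X 0 \<omega> = x} = 1"
    using start by (subst prob_Collect_eq_1) auto
  have pt: "prob {\<omega> \<in> space M. X t \<omega> = y} = pmf (P t x) y" if y: "y \<in> S" for y
  proof -
    define ts where "ts k = real k * t" for k :: nat
    define xs where "xs k = (if k = 0 then x else y)" for k :: nat
    have "prob {\<omega> \<in> space M. \<forall>k\<le>1. X (ts k) \<omega> = xs k} =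
        prob {\<omega> \<in> space M. X (ts 0) \<omega> = xs 0} * (\<Prod>k<1. pmf (P (ts (Suc k) - ts k) (xs k)) (xs (Suc k)))"
      using mp[unfolded markov_process_def, THEN conjunct2, THEN conjunct2, rule_format, of ts 1 xs] x y t
      by (simp add: ts_def xs_def)
    then have "prob {\<omega> \<in> space M. \<forall>k\<le>1. X (ts k) \<omega> = xs k} = pmf (P t x) y"
      by (simp add: ts_def xs_def start1)
    moreover have "prob {\<omega> \<in> space M. \<forall>k\<le>1. X (ts k) \<omega> = xs k} = prob {\<omega> \<in> space M. X t \<omega> = y}"
    proof (rule finite_measure_eq_AE)
      show "AE \<omega> in M. (\<omega> \<in> {\<omega> \<in> space M. \<forall>k\<le>1. X (ts k) \<omega> = xs k}) = (\<omega> \<in> {\<omega> \<in> space M. X t \<omega> = y})"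
        using start by eventually_elim (auto simp: ts_def xs_def le_Suc_eq)
      have "{\<omega> \<in> space M. \<forall>k\<le>1. X (ts k) \<omega> = xs k} = {\<omega> \<in> space M. X 0 \<omega> = x \<and> X t \<omega> = y}"
        by (auto simp: ts_def xs_def le_Suc_eq)
      then show "{\<omega> \<in> space M. \<forall>k\<le>1. X (ts k) \<omega> = xs k} \<in> events" by simp
    qed simp
    ultimately show ?thesis by simp
  qed
  have single: "emeasure (distr M (count_space UNIV) (X t)) {y} = emeasure (measure_pmf (P t x)) {y}"
    if "y \<in> S" for y
  proof -
    have "X t -` {y} \<inter> space M = {\<omega> \<in> space M. X t \<omega> = y}" by auto
    then show ?thesis
      using pt[OF that] by (simp add: emeasure_distr emeasure_eq_measure emeasure_pmf_single)
  qed
  let ?D = "set_pmf (P t x)"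
  have "emeasure (distr M (count_space UNIV) (X t)) ?D = (\<integral>\<^sup>+y. emeasure (distr M (count_space UNIV) (X t)) {y} \<partial>count_space ?D)"
    by (rule emeasure_countable_singleton) auto
  also have "\<dots> = (\<integral>\<^sup>+y. emeasure (measure_pmf (P t x)) {y} \<partial>count_space ?D)"
    by (rule nn_integral_cong) (use single P in auto)
  also have "\<dots> = emeasure (measure_pmf (P t x)) ?D"
    by (rule emeasure_countable_singleton[symmetric]) auto
  also have "\<dots> = 1"
    using measure_pmf.emeasure_eq_1_AE[of ?D "P t x"] by (simp add: AE_measure_pmf)
  finally have "AE y in distr M (count_space UNIV) (X t). y \<in> ?D"
    by (subst D.AE_in_set_eq_1) (auto simp: D.emeasure_eq_measure)
  then show ?thesis
    by (intro measure_eqI_countable_AE[where \<Omega>="?D"]) (use single P AE_measure_pmf in auto)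
qed

theorem theorem4:
  fixes d :: nat and lam :: real
    and P :: "nat \<Rightarrow> real \<Rightarrow> state \<Rightarrow> state pmf"
    and M :: "nat \<Rightarrow> 'w measure"
    and X :: "nat \<Rightarrow> real \<Rightarrow> 'w \<Rightarrow> state"
    and \<pi> :: "nat \<Rightarrow> state pmf"
  assumes "d \<ge> 1" and "0 < lam" and "lam < 1"
    and "\<And>n. n \<ge> d \<Longrightarrow> transition_function (states n d) (P n)"
    and "\<And>n. n \<ge> d \<Longrightarrow> has_jump_rates (states n d) (jump_rate n d lam) (P n)"
    and "\<And>n. n \<ge> d \<Longrightarrow> markov_process (states n d) (P n) (M n) (X n)"
    and "\<And>n. n \<ge> d \<Longrightarrow> AE \<omega> in M n. X n 0 \<omega> = (\<lambda>c. 0)"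
    and "\<And>n. n \<ge> d \<Longrightarrow> stationary_distribution (states n d) (P n) (\<pi> n)"
  shows "\<forall>\<epsilon>>0. \<exists>\<tau>\<ge>0. \<forall>n\<ge>d. \<forall>t\<ge>\<tau>.
           tv_dist (distr (M n) (count_space UNIV) (\<lambda>\<omega>. queue n d (X n t \<omega>) 1))
                   (measure_pmf (map_pmf (\<lambda>x. queue n d x 1) (\<pi> n))) \<le> \<epsilon>"
proof (intro allI impI)
  fix \<epsilon> :: real assume eps: "0 < \<epsilon>"
  let ?b = "mean_queue_bound lam"
  have b: "0 \<le> ?b" using assms(2,3) by (simp add: mean_queue_bound_def)
  \<comment> \<open>Half of \<epsilon> is spent on the remainders beyond \<open>K\<close>, the other
    half on the tail gaps at levels below \<open>K\<close>.\<close>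
  obtain K :: nat where "4 * ?b / \<epsilon> < real K" using reals_Archimedean2 by blast
  then have K: "2 * (?b / real (Suc K)) \<le> \<epsilon> / 2"
    using eps by (simp add: field_simps)
  define G where "G = (\<Sum>k<K. tail_factor d lam k)"
  have G: "0 \<le> G" unfolding G_def tail_factor_def using assms(2) by (intro sum_nonneg prod_nonneg) auto
  \<comment> \<open>Solves \<open>G * ?b / (t * d) \<le> \<epsilon> / 2\<close> for
    \<open>t\<close>; the summand 1 keeps \<open>t\<close> positive. Neither \<open>G\<close> nor
    \<open>?b\<close> involves \<open>n\<close>.\<close>
  define \<tau> where "\<tau> = 1 + 2 * G * ?b / (real d * \<epsilon>)"
  have \<tau>: "1 \<le> \<tau>" using G b eps by (simp add: \<tau>_def)
  have "tv_dist (distr (M n) (count_space UNIV) (\<lambda>\<omega>. queue n d (X n t \<omega>) 1))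
        (measure_pmf (map_pmf (\<lambda>x. queue n d x 1) (\<pi> n))) \<le> \<epsilon>"
    if n: "d \<le> n" and t: "\<tau> \<le> t" for n t
  proof -
    interpret stationary_parallel_servers n d lam "P n" "\<pi> n"
      by unfold_locales (use assms n in auto)
    have t0: "0 < t" using t \<tau> by linarith
    have mp: "markov_process ST (P n) (M n) (X n)" by (rule assms(6)[OF n])
    have [measurable]: "X n t \<in> measurable (M n) (count_space UNIV)"
      by (rule markov_process_measurable[OF mp]) (use t0 in simp)
    have "distr (M n) (count_space UNIV) (\<lambda>\<omega>. q (X n t \<omega>) 1)
      = distr (distr (M n) (count_space UNIV) (X n t)) (count_space UNIV) (\<lambda>x. q x 1)"
      by (simp add: distr_distr comp_def)
    also have "\<dots> = measure_pmf (map_pmf (\<lambda>x. q x 1) (P n t empty_state))"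
      using markov_process_law[OF mp empty_state assms(7)[OF n] set_P t0] t0
      by (simp add: map_pmf_rep_eq)
    finally have law: "distr (M n) (count_space UNIV) (\<lambda>\<omega>. q (X n t \<omega>) 1)
      = measure_pmf (map_pmf (\<lambda>x. q x 1) (P n t empty_state))" .
    have "2 * G * ?b / (real d * \<epsilon>) \<le> t" using t by (simp add: \<tau>_def)
    then have "G * (?b / (t * real d)) \<le> \<epsilon> / 2"
      using eps t0 assms(1) by (simp add: field_simps)
    then have bound: "G * (?b / (t * real d)) + 2 * (?b / real (Suc K)) \<le> \<epsilon>"
      using K by linarith
    show ?thesis
      unfolding tv_dist_def law
    proof (rule cSUP_least)
      fix A :: "nat set"
      \<comment> \<open>For total variation, \<open>g\<close> is taken to be the indicator of the
        arbitrary set \<open>A\<close>.\<close>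
      have m: "measure (measure_pmf (map_pmf (\<lambda>x. q x 1) p)) A = expect p (\<lambda>x. of_bool (q x 1 \<in> A))" for p
        using expect_of_bool[of p "(\<lambda>x. q x 1) -` A"] by simp
      show "\<bar>measure (measure_pmf (map_pmf (\<lambda>x. q x 1) (P n t empty_state))) A
          - measure (measure_pmf (map_pmf (\<lambda>x. q x 1) (\<pi> n))) A\<bar> \<le> \<epsilon>"
        unfolding m using expect_diff_le[of t "\<lambda>k. of_bool (k \<in> A)" K, OF t0] bound
        by (simp add: G_def)
    qed simp
  qed
  then show "\<exists>\<tau>\<ge>0. \<forall>n\<ge>d. \<forall>t\<ge>\<tau>.
      tv_dist (distr (M n) (count_space UNIV) (\<lambda>\<omega>. queue n d (X n t \<omega>) 1))
        (measure_pmf (map_pmf (\<lambda>x. queue n d x 1) (\<pi> n))) \<le> \<epsilon>"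
    using \<tau> by (intro exI[of _ \<tau>]) auto
qed

end
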